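(* Let $w_1,\dots,w_p$ be reduced words in the free group $F_2=\langle a,b\rangle$ and let $W_1,\dots,W_p$ be the corresponding functions on $\mathcal{U}(N)^2$. An integral of the form $$\iint_{\mathcal{U}(N)^2} (\operatorname{Tr}(W_1))^{\alpha_1}\,(\overline{\operatorname{Tr}(W_1)})^{\beta_1}\cdots(\operatorname{Tr}(W_p))^{\alpha_p}\,(\overline{\operatorname{Tr}(W_p)})^{\beta_p}\,dU\,dV$$ is, modulo $O\big(\tfrac1N\big)$, non-zero if and only if it can be written in the form $$\iint_{\mathcal{U}(N)^2}|\operatorname{Tr}(W_1)|^{2\alpha_1}\cdots|\operatorname{Tr}(W_p)|^{2\alpha_p}\,dU\,dV,$$ in which case it is equal (modulo $O\big(\tfrac1N\big)$) to $$\alpha_1!\cdots\alpha_p!\;j_1^{\alpha_1}\cdots j_p^{\alpha_p},$$ where $j_i=j(w_i)$ is the number of cyclic rotations of the word $w_i$ that leave $w_i$ invariant. Consequently, $\operatorname{Tr}(W_1),\dots,\operatorname{Tr}(W_p)$ have the asymptotic moment distribution (as $N\to\infty$) of $\sqrt{j_1}\,Z_1,\dots,\sqrt{j_p}\,Z_p$, where $Z_1,\dots,Z_p$ are independent normal Gaussian variables.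
   Context: $\mathcal{U}(N)$ is the group of $N\times N$ unitary matrices, $dU$ and $dV$ denote its Haar measure, and $\operatorname{Tr}$ is the non-normalized trace on $M_N(\mathbb{C})$. For a word $w_i$ in $F_2=\langle a,b\rangle$, the function $W_i=W_i(U,V)$, $(U,V)\in\mathcal{U}(N)^2$, is obtained by substituting $(U,V)$ for $(a,b)$ in $w_i$. The exponents $\alpha_i,\beta_i$ are non-negative integers, and $O(1/N)$ refers to $N\to\infty$.
   Formalization: The words are taken non-empty and pairwise not conjugate to each other or to each other's inverses (w1=w2=a gives 2, not 1), and j(w) counts rotations of the cyclic reduction of w (literal count fails for baab^{-1}); Gaussians are standard complex. *)

theory Defs
  imports "HOL-Probability.Probability" "Jordan_Normal_Form.Schur_Decomposition"
begin

datatype gen = GenA | GenB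

text \<open>The letter \<open>(x, True)\<close> stands for the generator \<open>x\<close>, the letter \<open>(x, False)\<close> for its inverse.\<close>

type_synonym letter = "gen \<times> bool"
type_synonym word = "letter list"

definition inv_letter :: "letter \<Rightarrow> letter" where
  "inv_letter l = (fst l, \<not> snd l)"

definition inv_word :: "word \<Rightarrow> word" where
  "inv_word w = rev (map inv_letter w)"

definition reduced :: "word \<Rightarrow> bool" where
  "reduced w \<longleftrightarrow> successively (\<lambda>x y. y \<noteq> inv_letter x) w"

definition cyclically_reduced :: "word \<Rightarrow> bool" where
  "cyclically_reduced w \<longleftrightarrow> reduced w \<and> (w \<noteq> [] \<longrightarrow> hd w \<noteq> inv_letter (last w))"

text \<open>The cyclic reduction: outer pairs \<open>x \<dots> x\<inverse>\<close> are stripped off, so that a reduced word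
  becomes a cyclically reduced conjugate of itself.\<close>

function cyclic_reduction :: "word \<Rightarrow> word" where
  "cyclic_reduction w =
     (if w \<noteq> [] \<and> hd w = inv_letter (last w) then cyclic_reduction (butlast (tl w)) else w)"
  by auto
termination by (relation "Wellfounded.measure length") (auto simp: neq_Nil_conv)

declare cyclic_reduction.simps [simp del]

definition cyclically_equivalent :: "word \<Rightarrow> word \<Rightarrow> bool" where
  "cyclically_equivalent v w \<longleftrightarrow> (\<exists>k. rotate k (cyclic_reduction v) = cyclic_reduction w)"

text \<open>The number \<open>j(w)\<close> of cyclic rotations (the trivial one included) that leave \<open>w\<close> invariant.
  Here \<open>w\<close> is read as a cyclic word, so the rotations act on its cyclic reduction; for a cyclically
  reduced word this is the literal count, see \<open>rotation_count_cyclically_reduced\<close>. The distinction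
  matters for words such as \<open>b a a b\<inverse>\<close>: it has the same trace as \<open>a a\<close> and hence needs
  \<open>j = 2\<close>, although only the trivial rotation fixes it as a list of letters.\<close>

definition rotation_count :: "word \<Rightarrow> nat" where
  "rotation_count w =
     card {k. k < length (cyclic_reduction w) \<and> rotate k (cyclic_reduction w) = cyclic_reduction w}"

lemma rotation_count_cyclically_reduced:
  assumes "cyclically_reduced w"
  shows "rotation_count w = card {k. k < length w \<and> rotate k w = w}"
proof -
  have "cyclic_reduction w = w"
    using assms by (subst cyclic_reduction.simps) (auto simp: cyclically_reduced_def)
  then show ?thesis
    by (simp add: rotation_count_def)
qed

definition unitary_group :: "nat \<Rightarrow> complex mat set" where
  "unitary_group N =
     {U \<in> carrier_mat N N. U * mat_adjoint U = 1\<^sub>m N \<and> mat_adjoint U * U = 1\<^sub>m N}"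

text \<open>The library puts no topology on the type of matrices. The sigma-algebra
  generated by the \<open>N\<^sup>2\<close> entry maps is the Borel sigma-algebra of the unitary group as a
  subspace of the \<open>N\<times>N\<close> complex matrices.\<close>

definition unitary_borel :: "nat \<Rightarrow> complex mat measure" where
  "unitary_borel N = vimage_algebra (unitary_group N)
     (\<lambda>U. \<lambda>ij\<in>{..<N} \<times> {..<N}. U $$ ij) (Pi\<^sub>M ({..<N} \<times> {..<N}) (\<lambda>_. borel))"

text \<open>Haar measure of the compact group: the bi-invariant Borel probability measure.\<close>

definition is_haar_unitary :: "nat \<Rightarrow> complex mat measure \<Rightarrow> bool" where
  "is_haar_unitary N \<mu> \<longleftrightarrow>
     prob_space \<mu> \<and> sets \<mu> = sets (unitary_borel N) \<and>
     (\<forall>G\<in>unitary_group N. distr \<mu> \<mu> (\<lambda>U. G * U) = \<mu> \<and> distr \<mu> \<mu> (\<lambda>U. U * G) = \<mu>)"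

definition mat_trace :: "complex mat \<Rightarrow> complex" where
  "mat_trace A = (\<Sum>i<dim_row A. A $$ (i, i))"

text \<open>The inverse of a generator is sent to the adjoint, which is the inverse for unitary
  matrices.\<close>

fun letter_eval :: "complex mat \<Rightarrow> complex mat \<Rightarrow> letter \<Rightarrow> complex mat" where
  "letter_eval U V (GenA, True) = U"
| "letter_eval U V (GenA, False) = mat_adjoint U"
| "letter_eval U V (GenB, True) = V"
| "letter_eval U V (GenB, False) = mat_adjoint V"

definition word_eval :: "nat \<Rightarrow> complex mat \<Rightarrow> complex mat \<Rightarrow> word \<Rightarrow> complex mat" where
  "word_eval N U V w = foldr (\<lambda>l A. letter_eval U V l * A) w (1\<^sub>m N)"

definition word_trace :: "nat \<Rightarrow> complex mat \<Rightarrow> complex mat \<Rightarrow> word \<Rightarrow> complex" where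
  "word_trace N U V w = mat_trace (word_eval N U V w)"

definition trace_moment ::
  "(nat \<Rightarrow> complex mat measure) \<Rightarrow> nat \<Rightarrow> (nat \<Rightarrow> word) \<Rightarrow> (nat \<Rightarrow> nat) \<Rightarrow> (nat \<Rightarrow> nat) \<Rightarrow> nat \<Rightarrow> complex" where
  "trace_moment \<mu> p w \<alpha> \<beta> N =
     (\<integral>UV. (\<Prod>i<p. word_trace N (fst UV) (snd UV) (w i) ^ \<alpha> i
                  * cnj (word_trace N (fst UV) (snd UV) (w i)) ^ \<beta> i) \<partial>(\<mu> N \<Otimes>\<^sub>M \<mu> N))"

definition abs_trace_moment ::
  "(nat \<Rightarrow> complex mat measure) \<Rightarrow> nat \<Rightarrow> (nat \<Rightarrow> word) \<Rightarrow> (nat \<Rightarrow> nat) \<Rightarrow> nat \<Rightarrow> real" where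
  "abs_trace_moment \<mu> p w \<alpha> N =
     (\<integral>UV. (\<Prod>i<p. cmod (word_trace N (fst UV) (snd UV) (w i)) ^ (2 * \<alpha> i)) \<partial>(\<mu> N \<Otimes>\<^sub>M \<mu> N))"

text \<open>Standard complex Gaussian, normalised by \<open>E \<bar>Z\<bar>\<^sup>2 = 1\<close>; its density is taken with respect
  to the planar Lebesgue measure.\<close>

definition standard_complex_gaussian :: "'m measure \<Rightarrow> ('m \<Rightarrow> complex) \<Rightarrow> bool" where
  "standard_complex_gaussian M Z \<longleftrightarrow>
     distributed M lborel Z (\<lambda>z. ennreal (exp (- (cmod z)\<^sup>2) / pi))"

end

theory Submission
  imports Defs
begin

text \<open>The proof rests on the loop equation of the Haar measure instead of explicit integration
  formulas for the entries of a Haar unitary.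

  Invariance under \<open>U \<mapsto> exp (i t Q) U\<close> makes the expected derivative of any polynomial in the
  entries and their conjugates vanish (\<open>integral_translation_derivative\<close>). For the entries of a word
  \<open>w\<close>, multiplied by traces of other words, this becomes an identity between moments
  (\<open>schwinger_dyson\<close>): its terms either split \<open>w\<close> in two at one of its letters, or join \<open>w\<close> with one
  of the other words \<open>v\<close>. A factor \<open>N\<close>, the
  trace of the identity, appears only where a trivial word arises. If all words are cyclically reduced
  and \<open>w\<close> is rotated suitably, this happens for one splitting, which gives back \<open>N\<close> times the original
  moment, and for those joinings where a rotation of \<open>v\<close> is inverse to \<open>w\<close>, so that both words
  disappear (\<open>dominant_terms\<close>).

  All other terms are moments of nontrivial words of at most the same total length. Those moments are
  bounded uniformly in \<open>N\<close>: after division by \<open>N\<close> the terms of equal length can be absorbed into the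
  left-hand side, which leaves an induction on the total length (\<open>moments_bounded\<close>). Hence, modulo
  \<open>O(1/N)\<close>, a moment with a factor \<open>w\<close> is the sum, over the factors \<open>v\<close> and the rotations of \<open>v\<close> inverse
  to \<open>w\<close>, of the moments without \<open>w\<close> and \<open>v\<close> (\<open>moment_recursion\<close>).

  The words \<open>w\<^sub>i\<close> are pairwise neither conjugate nor conjugate to each other's inverses, and no
  nontrivial element of a free group is conjugate to its own inverse (\<open>rotate_neq_inv_word\<close>). So the
  trace of \<open>w\<^sub>i\<close> can be paired only with its own conjugate, in \<open>j(w\<^sub>i)\<close> ways, and the recursion yields
  the product of the numbers \<open>\<alpha>\<^sub>i! j\<^sub>i^\<alpha>\<^sub>i\<close> or zero (\<open>moment_pairings\<close>). The moments of a complex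
  Gaussian satisfy the same recursion by Stein's identity (\<open>gaussian_moment_Suc\<close>).\<close>

section \<open>Cyclic words in the free group\<close>

lemma inv_letter_inv_letter [simp]: "inv_letter (inv_letter l) = l"
  by (simp add: inv_letter_def)

lemma inv_letter_neq [simp]: "inv_letter l \<noteq> l" "l \<noteq> inv_letter l"
  by (auto simp: inv_letter_def prod_eq_iff)

lemma inv_word_simps [simp]:
  "inv_word [] = []"
  "inv_word (u @ v) = inv_word v @ inv_word u"
  "inv_word (x # v) = inv_word v @ [inv_letter x]"
  "inv_word (inv_word u) = u"
  "length (inv_word u) = length u"
  by (simp_all add: inv_word_def rev_map comp_def)

lemma inv_word_eq_Nil_iff [simp]: "inv_word u = [] \<longleftrightarrow> u = []"
  by (simp add: inv_word_def)

lemma inv_word_eq_iff [simp]: "inv_word u = inv_word v \<longleftrightarrow> u = v"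
  by (metis inv_word_simps(4))

lemma hd_inv_word: "u \<noteq> [] \<Longrightarrow> hd (inv_word u) = inv_letter (last u)"
  by (simp add: inv_word_def hd_rev last_map)

lemma last_inv_word: "u \<noteq> [] \<Longrightarrow> last (inv_word u) = inv_letter (hd u)"
  by (simp add: inv_word_def last_rev hd_map)

lemma reduced_Nil [simp]: "reduced []"
  by (simp add: reduced_def)

lemma reduced_append_iff:
  "reduced (u @ v) \<longleftrightarrow>
     reduced u \<and> reduced v \<and> (u = [] \<or> v = [] \<or> hd v \<noteq> inv_letter (last u))"
  by (auto simp: reduced_def successively_append_iff)

lemma reduced_Cons_iff: "reduced (x # v) \<longleftrightarrow> reduced v \<and> (v = [] \<or> hd v \<noteq> inv_letter x)"
  by (auto simp: reduced_def successively_Cons)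

lemma reduced_inv_word [simp]: "reduced (inv_word u) \<longleftrightarrow> reduced u"
  unfolding reduced_def inv_word_def successively_rev successively_map
  by (rule successively_cong) auto

lemma reduced_take: "reduced w \<Longrightarrow> reduced (take k w)"
  using reduced_append_iff[of "take k w" "drop k w"] by simp

lemma reduced_drop: "reduced w \<Longrightarrow> reduced (drop k w)"
  using reduced_append_iff[of "take k w" "drop k w"] by simp

lemma cyclically_reduced_inv_word [simp]:
  "cyclically_reduced (inv_word w) \<longleftrightarrow> cyclically_reduced w"
  by (auto simp: cyclically_reduced_def hd_inv_word last_inv_word)

text \<open>Repeating the word makes its seam an interior position, so that rotating the word no longer
  affects the condition.\<close>

lemma cyclically_reduced_iff_reduced_square: "cyclically_reduced w \<longleftrightarrow> reduced (w @ w)"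
  by (auto simp: cyclically_reduced_def reduced_append_iff)

lemma cyclically_reduced_rotate [simp]:
  "cyclically_reduced (rotate n w) \<longleftrightarrow> cyclically_reduced w"
proof -
  have *: "cyclically_reduced (v @ u)" if "cyclically_reduced (u @ v)" for u v
    using that
    by (cases "u = []"; cases "v = []")
       (auto simp: cyclically_reduced_iff_reduced_square reduced_append_iff)
  have "cyclically_reduced (drop m w @ take m w) \<longleftrightarrow> cyclically_reduced w" for m
    using *[of "take m w" "drop m w"] *[of "drop m w" "take m w"] by auto
  then show ?thesis
    by (simp add: rotate_drop_take)
qed

lemma rotate_inv_word_rotate: "rotate k (inv_word (rotate k w)) = inv_word w"
proof (induction k arbitrary: w)
  case (Suc k)
  have 1: "rotate1 (inv_word (rotate1 w)) = inv_word w" for w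
    by (cases w) auto
  have "rotate (Suc k) (inv_word (rotate (Suc k) w)) =
      rotate1 (rotate k (inv_word (rotate k (rotate1 w))))"
    by (simp add: rotate1_rotate_swap)
  then show ?case by (simp only: Suc.IH 1)
qed simp

definition rotation_equiv :: "word \<Rightarrow> word \<Rightarrow> bool" where
  "rotation_equiv v w \<longleftrightarrow> (\<exists>n. rotate n v = w)"

lemma rotation_equiv_rotate [simp]: "rotation_equiv v (rotate n v)"
  by (auto simp: rotation_equiv_def)

lemma rotation_equiv_sym:
  assumes "rotation_equiv v w"
  shows "rotation_equiv w v"
proof -
  obtain n where w: "w = rotate n v" using assms by (auto simp: rotation_equiv_def)
  have "rotate (n * (length v - 1)) w = rotate (n * length v) v"
    unfolding w rotate_rotate by (cases v) (auto simp: algebra_simps)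
  also have "\<dots> = v" by (rule rotate_id) simp
  finally show ?thesis by (auto simp: rotation_equiv_def)
qed

lemma rotation_equiv_trans: "rotation_equiv u v \<Longrightarrow> rotation_equiv v w \<Longrightarrow> rotation_equiv u w"
  by (auto simp: rotation_equiv_def rotate_rotate)

lemma rotation_equiv_inv_word:
  assumes "rotation_equiv v w"
  shows "rotation_equiv (inv_word v) (inv_word w)"
proof (rule rotation_equiv_sym)
  obtain n where w: "w = rotate n v" using assms by (auto simp: rotation_equiv_def)
  have "rotate n (inv_word w) = inv_word v" by (simp only: w rotate_inv_word_rotate)
  then show "rotation_equiv (inv_word w) (inv_word v)" by (auto simp: rotation_equiv_def)
qed

lemma rotation_stabilizer_rotate:
  fixes w :: word
  shows "{k. k < length (rotate n w) \<and> rotate k (rotate n w) = rotate n w} = {k. k < length w \<and> rotate k w = w}"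
proof -
  have *: "rotate k (rotate n v) = rotate n v" if "rotate k v = v" for k n and v :: word
    using that by (metis add.commute rotate_rotate)
  obtain m where m: "rotate m (rotate n w) = w"
    using rotation_equiv_sym[OF rotation_equiv_rotate[of w n]] by (auto simp: rotation_equiv_def)
  have "rotate k (rotate n w) = rotate n w \<longleftrightarrow> rotate k w = w" for k
    using *[of k w n] *[of k "rotate n w" m] unfolding m by blast
  then show ?thesis by simp
qed

text \<open>Peeling off the first and the last letter, which are inverse to each other, one arrives at a
  single letter or at two adjacent inverse letters.\<close>

lemma reduced_not_self_inverse: "reduced w \<Longrightarrow> inv_word w = w \<Longrightarrow> w = []"
proof (induction "length w" arbitrary: w rule: less_induct)
  case less
  show ?case
  proof (rule ccontr)
    assume "w \<noteq> []"
    then obtain x u where w: "w = x # u" by (cases w) auto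
    have "u \<noteq> []" using less.prems w by auto
    then obtain v y where u: "u = v @ [y]" by (metis rev_exhaust)
    have v: "inv_word v = v" and y: "y = inv_letter x"
      using less.prems(2) unfolding w u by auto
    have "reduced v" using less.prems(1) unfolding w u
      by (auto simp: reduced_Cons_iff reduced_append_iff)
    with less.hyps[of v] v w u have "v = []" by simp
    then show False using less.prems(1) y unfolding w u by (simp add: reduced_Cons_iff)
  qed
qed

text \<open>A nontrivial element of a free group is not conjugate to its own inverse: if
  \<open>w = x y\<close> and \<open>y x = y\<inverse> x\<inverse>\<close> as words, then \<open>x\<close> and \<open>y\<close> are their own inverses and hence empty.\<close>

lemma rotate_neq_inv_word:
  assumes "reduced w" "w \<noteq> []"
  shows "rotate k w \<noteq> inv_word w"
proof
  assume eq: "rotate k w = inv_word w"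
  let ?m = "k mod length w"
  have m: "?m < length w" using assms by simp
  have "drop ?m w @ take ?m w = inv_word (take ?m w @ drop ?m w)"
    using eq by (simp add: rotate_drop_take)
  then have "inv_word (drop ?m w) = drop ?m w"
    unfolding inv_word_simps by (subst (asm) append_eq_append_conv) auto
  then have "drop ?m w = []"
    using reduced_not_self_inverse reduced_drop assms by blast
  then show False using m by simp
qed

lemma cyclic_reduction_cases:
  assumes "reduced w" "w \<noteq> []"
  obtains "hd w \<noteq> inv_letter (last w)" "cyclic_reduction w = w"
  | x u where "w = inv_letter x # u @ [x]" "u \<noteq> []" "reduced u"
      "cyclic_reduction w = cyclic_reduction u"
proof (cases "hd w = inv_letter (last w)")
  case False
  moreover from this have "cyclic_reduction w = w" by (subst cyclic_reduction.simps) simp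
  ultimately show ?thesis using that(1) by blast
next
  case True
  obtain y v where w: "w = y # v" using assms by (cases w) auto
  have "v \<noteq> []" using True w by auto
  then obtain u x where v: "v = u @ [x]" by (metis rev_exhaust)
  have "y = inv_letter x" using True w v by simp
  moreover have "cyclic_reduction w = cyclic_reduction u"
    using True w v by (subst cyclic_reduction.simps) simp
  moreover have "u \<noteq> []" "reduced u" using assms w v \<open>y = inv_letter x\<close>
    by (auto simp: reduced_Cons_iff reduced_append_iff)
  ultimately show ?thesis using that(2) w v by simp
qed

lemma cyclic_reduction_Nil [simp]: "cyclic_reduction [] = []"
  by (subst cyclic_reduction.simps) simp

lemma cyclically_reduced_cyclic_reduction:
  assumes "reduced w" "w \<noteq> []"
  shows "cyclically_reduced (cyclic_reduction w) \<and> cyclic_reduction w \<noteq> []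
    \<and> length (cyclic_reduction w) \<le> length w"
  using assms
proof (induction "length w" arbitrary: w rule: less_induct)
  case less
  from less.prems show ?case
  proof (cases rule: cyclic_reduction_cases)
    case 1
    then show ?thesis using less.prems by (simp add: cyclically_reduced_def)
  next
    case (2 x u)
    then show ?thesis using less.hyps[of u] by simp
  qed
qed

lemma cyclic_reduction_inv_word:
  assumes "reduced w"
  shows "cyclic_reduction (inv_word w) = inv_word (cyclic_reduction w)"
  using assms
proof (induction "length w" arbitrary: w rule: less_induct)
  case less
  show ?case
  proof (cases "w = []")
    case False
    with less.prems show ?thesis
    proof (cases rule: cyclic_reduction_cases)
      case 1
      then have "hd (inv_word w) \<noteq> inv_letter (last (inv_word w))"
        using False by (auto simp: hd_inv_word last_inv_word)
      with 1 show ?thesis by (subst cyclic_reduction.simps) simp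
    next
      case (2 x u)
      then have "cyclic_reduction (inv_word w) = cyclic_reduction (inv_word u)"
        by (subst cyclic_reduction.simps) (simp add: butlast_append)
      with 2 less.hyps[of u] show ?thesis by simp
    qed
  qed simp
qed

lemma cyclically_equivalent_iff:
  "cyclically_equivalent v w \<longleftrightarrow> rotation_equiv (cyclic_reduction v) (cyclic_reduction w)"
  by (simp add: cyclically_equivalent_def rotation_equiv_def)

lemma rotation_count_pos:
  assumes "reduced w" "w \<noteq> []"
  shows "rotation_count w > 0"
proof -
  have "0 \<in> {k. k < length (cyclic_reduction w) \<and> rotate k (cyclic_reduction w) = cyclic_reduction w}"
    using cyclically_reduced_cyclic_reduction[OF assms] by simp
  then show ?thesis unfolding rotation_count_def by (subst card_gt_0_iff) auto
qed

text \<open>Cancellation at the seam of two reduced words can exhaust both of them only if they are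
  mutually inverse. The map \<open>R\<close> stands for any evaluation that does not see cancellations; it is
  used with the evaluation at unitary matrices.\<close>

lemma reduce_product:
  assumes "reduced u" "reduced v" "v \<noteq> inv_word u"
    and cancel: "\<And>a x b. R (a @ [x, inv_letter x] @ b) = R (a @ b)"
  shows "\<exists>r. reduced r \<and> r \<noteq> [] \<and> length r \<le> length u + length v \<and> R r = R (u @ v)"
  using assms(1-3)
proof (induction u arbitrary: v rule: rev_induct)
  case Nil
  then show ?case by auto
next
  case (snoc x u)
  show ?case
  proof (cases "v \<noteq> [] \<and> hd v = inv_letter x")
    case True
    then obtain v' where v: "v = inv_letter x # v'" by (cases v) auto
    have "reduced u" "reduced v'" "v' \<noteq> inv_word u"
      using snoc.prems v by (auto simp: reduced_append_iff reduced_Cons_iff)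
    from snoc.IH[OF this] obtain r where
      "reduced r" "r \<noteq> []" "length r \<le> length u + length v'" "R r = R (u @ v')" by blast
    moreover have "R ((u @ [x]) @ v) = R (u @ v')" using cancel[of u x v'] v by simp
    ultimately show ?thesis using v by (intro exI[of _ r]) auto
  next
    case False
    then have "reduced ((u @ [x]) @ v)"
      using snoc.prems by (auto simp: reduced_append_iff reduced_Cons_iff)
    then show ?thesis by (intro exI[of _ "(u @ [x]) @ v"]) auto
  qed
qed

text \<open>The ways to glue the cyclic word \<open>v\<close> to \<open>w\<close> so that both cancel completely.\<close>

definition matchings :: "word \<Rightarrow> word \<Rightarrow> nat" where
  "matchings w v = card {k. k < length v \<and> rotate k v = inv_word w}"

lemma matchings_le: "matchings w v \<le> length v"
proof -
  have "matchings w v \<le> card {..<length v}"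
    unfolding matchings_def by (intro card_mono) auto
  then show ?thesis by simp
qed

lemma matchings_conv_sum:
  "(of_nat (matchings w v) :: 'a :: ring_1) = (\<Sum>k<length v. if rotate k v = inv_word w then 1 else 0)"
proof -
  have "(\<Sum>k<length v. if rotate k v = inv_word w then 1 else 0 :: 'a)
      = of_nat (card ({..<length v} \<inter> {k. rotate k v = inv_word w}))"
    by (simp add: sum.If_cases)
  also have "{..<length v} \<inter> {k. rotate k v = inv_word w} = {k. k < length v \<and> rotate k v = inv_word w}"
    by auto
  finally show ?thesis by (simp add: matchings_def)
qed

lemma matchings_conv_sum_Suc:
  "(of_nat (matchings w v) :: 'a :: ring_1) = (\<Sum>k<length v. if rotate (Suc k) v = inv_word w then 1 else 0)"
proof -
  let ?f = "\<lambda>k. if rotate k v = inv_word w then 1 else 0 :: 'a"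
  have "(\<Sum>k<length v. ?f (Suc k)) + ?f 0 = (\<Sum>k<Suc (length v). ?f k)"
    by (subst sum.lessThan_Suc_shift) (simp add: add.commute)
  also have "\<dots> = (\<Sum>k<length v. ?f k) + ?f (length v)" by simp
  finally show ?thesis by (simp add: matchings_conv_sum del: rotate_Suc)
qed

lemma matchings_eq_0:
  "\<not> rotation_equiv v (inv_word w) \<Longrightarrow> matchings w v = 0"
  by (auto simp: matchings_def rotation_equiv_def)

text \<open>A word and its inverse have the same rotational symmetries, so the matchings of a word with its
  own inverse are counted by \<open>j\<close>.\<close>

lemma matchings_self_inverse:
  "matchings w (inv_word w) = card {k. k < length w \<and> rotate k w = w}"
proof -
  have *: "rotate k (inv_word u) = inv_word u" if "rotate k u = u" for k u
    using rotate_inv_word_rotate[of k u] that by simp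
  have "rotate k (inv_word w) = inv_word w \<longleftrightarrow> rotate k w = w" for k
    using *[of k w] *[of k "inv_word w"] by auto
  then show ?thesis unfolding matchings_def by simp
qed

section \<open>Traces of words in unitary matrices\<close>

lemma dim_mat_adjoint [simp]:
  "dim_row (mat_adjoint A) = dim_col A" "dim_col (mat_adjoint A) = dim_row A"
  by (simp_all add: mat_adjoint_def)

lemma mat_adjoint_carrier [simp]: "A \<in> carrier_mat n m \<Longrightarrow> mat_adjoint A \<in> carrier_mat m n"
  by (intro carrier_matI) auto

lemma mat_adjoint_index:
  fixes A :: "complex mat"
  shows "i < dim_col A \<Longrightarrow> j < dim_row A \<Longrightarrow> mat_adjoint A $$ (i, j) = cnj (A $$ (j, i))"
  by (simp add: mat_adjoint_def mat_of_rows_def)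

lemma mat_adjoint_mult:
  fixes A B :: "complex mat"
  assumes "A \<in> carrier_mat n m" "B \<in> carrier_mat m k"
  shows "mat_adjoint (A * B) = mat_adjoint B * mat_adjoint A"
  using assms by (intro eq_matI) (auto simp: mat_adjoint_index scalar_prod_def mult.commute)

lemma mat_adjoint_adjoint [simp]: "mat_adjoint (mat_adjoint A) = (A :: complex mat)"
  by (intro eq_matI) (auto simp: mat_adjoint_index)

lemma mat_adjoint_one [simp]: "mat_adjoint (1\<^sub>m n :: complex mat) = 1\<^sub>m n"
  by (intro eq_matI) (auto simp: mat_adjoint_index)

lemma index_mult_mat_sum:
  assumes "A \<in> carrier_mat n m" "B \<in> carrier_mat m k" "i < n" "j < k"
  shows "(A * B) $$ (i, j) = (\<Sum>l<m. A $$ (i, l) * B $$ (l, j))"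
  using assms by (auto simp: scalar_prod_def atLeast0LessThan)

lemma unitary_groupD:
  assumes "U \<in> unitary_group N"
  shows "U \<in> carrier_mat N N" "U * mat_adjoint U = 1\<^sub>m N" "mat_adjoint U * U = 1\<^sub>m N"
  using assms by (auto simp: unitary_group_def)

lemma unitary_group_one: "1\<^sub>m N \<in> unitary_group N"
  by (simp add: unitary_group_def)

lemma unitary_group_adjoint: "U \<in> unitary_group N \<Longrightarrow> mat_adjoint U \<in> unitary_group N"
  by (simp add: unitary_group_def)

lemma unitary_group_mult:
  assumes "U \<in> unitary_group N" "V \<in> unitary_group N"
  shows "U * V \<in> unitary_group N"
proof -
  note c = unitary_groupD[OF assms(1)] unitary_groupD[OF assms(2)]
  have c': "mat_adjoint U \<in> carrier_mat N N" "mat_adjoint V \<in> carrier_mat N N"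
    using c by simp_all
  have "U * V * (mat_adjoint V * mat_adjoint U) = U * (V * (mat_adjoint V * mat_adjoint U))"
    using c c' by (intro assoc_mult_mat) auto
  also have "V * (mat_adjoint V * mat_adjoint U) = V * mat_adjoint V * mat_adjoint U"
    using c c' by (intro assoc_mult_mat[symmetric]) auto
  also have "U * \<dots> = 1\<^sub>m N"
    using c c' by simp
  finally have 1: "U * V * (mat_adjoint V * mat_adjoint U) = 1\<^sub>m N" .
  have "mat_adjoint V * mat_adjoint U * (U * V) = mat_adjoint V * (mat_adjoint U * (U * V))"
    using c c' by (intro assoc_mult_mat) auto
  also have "mat_adjoint U * (U * V) = mat_adjoint U * U * V"
    using c c' by (intro assoc_mult_mat[symmetric]) auto
  also have "mat_adjoint V * \<dots> = 1\<^sub>m N"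
    using c c' by simp
  finally have 2: "mat_adjoint V * mat_adjoint U * (U * V) = 1\<^sub>m N" .
  show ?thesis using 1 2 c
    by (auto simp: unitary_group_def mat_adjoint_mult[of U N N V N])
qed

lemma unitary_entry_le_1:
  assumes "U \<in> unitary_group N" "i < N" "j < N"
  shows "cmod (U $$ (i, j)) \<le> 1"
proof -
  note U = unitary_groupD[OF assms(1)]
  have "(\<Sum>k<N. U $$ (i, k) * mat_adjoint U $$ (k, i)) = (U * mat_adjoint U) $$ (i, i)"
    using U assms by (subst index_mult_mat_sum[of _ N N _ N]) auto
  also have "\<dots> = 1" using U assms by simp
  also have "(\<Sum>k<N. U $$ (i, k) * mat_adjoint U $$ (k, i)) = of_real (\<Sum>k<N. (cmod (U $$ (i, k)))\<^sup>2)"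
    using U assms by (simp add: mat_adjoint_index complex_norm_square del: of_real_power)
  finally have "(\<Sum>k<N. (cmod (U $$ (i, k)))\<^sup>2) = 1"
    using of_real_eq_1_iff by blast
  moreover have "(cmod (U $$ (i, j)))\<^sup>2 \<le> (\<Sum>k<N. (cmod (U $$ (i, k)))\<^sup>2)"
    using assms by (intro member_le_sum) auto
  ultimately show ?thesis by (simp add: power_le_one_iff)
qed

lemma mat_trace_conv_sum: "A \<in> carrier_mat N N \<Longrightarrow> mat_trace A = (\<Sum>i<N. A $$ (i, i))"
  by (auto simp: mat_trace_def)

lemma mat_trace_mult:
  assumes "A \<in> carrier_mat N N" "B \<in> carrier_mat N N"
  shows "mat_trace (A * B) = (\<Sum>i<N. \<Sum>j<N. A $$ (i, j) * B $$ (j, i))"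
  using assms by (simp add: mat_trace_conv_sum[of _ N] index_mult_mat_sum[of _ N N _ N] del: index_mult_mat)

lemma mat_trace_mult_commute:
  assumes "A \<in> carrier_mat N N" "B \<in> carrier_mat N N"
  shows "mat_trace (A * B) = mat_trace (B * A)"
  unfolding mat_trace_mult[OF assms] mat_trace_mult[OF assms(2,1)]
  by (subst sum.swap) (simp add: mult.commute)

lemma letter_eval_inv_letter: "letter_eval U V (inv_letter l) = mat_adjoint (letter_eval U V l)"
  by (cases "(U, V, l)" rule: letter_eval.cases) (auto simp: inv_letter_def)

lemma letter_eval_unitary:
  assumes "U \<in> unitary_group N" "V \<in> unitary_group N"
  shows "letter_eval U V l \<in> unitary_group N"
  using assms by (cases "(U, V, l)" rule: letter_eval.cases) (auto intro: unitary_group_adjoint)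

lemma word_eval_Nil [simp]: "word_eval N U V [] = 1\<^sub>m N"
  and word_eval_Cons [simp]: "word_eval N U V (l # w) = letter_eval U V l * word_eval N U V w"
  by (simp_all add: word_eval_def)

lemma word_eval_unitary:
  assumes "U \<in> unitary_group N" "V \<in> unitary_group N"
  shows "word_eval N U V w \<in> unitary_group N"
  using assms by (induction w) (auto intro: unitary_group_one unitary_group_mult letter_eval_unitary)

lemma word_eval_append:
  assumes "U \<in> unitary_group N" "V \<in> unitary_group N"
  shows "word_eval N U V (u @ v) = word_eval N U V u * word_eval N U V v"
proof (induction u)
  case Nil
  then show ?case using unitary_groupD(1)[OF word_eval_unitary[OF assms]] by (simp add: left_mult_one_mat[of _ N N])
next
  case (Cons l u)
  then show ?case
    using unitary_groupD(1)[OF word_eval_unitary[OF assms]] unitary_groupD(1)[OF letter_eval_unitary[OF assms]]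
    by (simp add: assoc_mult_mat[of _ N N _ N _ N])
qed

lemma word_eval_inv_word:
  assumes "U \<in> unitary_group N" "V \<in> unitary_group N"
  shows "word_eval N U V (inv_word w) = mat_adjoint (word_eval N U V w)"
proof (induction w)
  case (Cons l w)
  note c = unitary_groupD(1)[OF word_eval_unitary[OF assms]] unitary_groupD(1)[OF letter_eval_unitary[OF assms]]
  show ?case using c Cons
    by (simp add: word_eval_append[OF assms] letter_eval_inv_letter mat_adjoint_mult[OF c(2) c(1)]
         right_mult_one_mat[of _ N N])
qed simp

abbreviation unitary_pairs :: "nat \<Rightarrow> (complex mat \<times> complex mat) set" where
  "unitary_pairs N \<equiv> unitary_group N \<times> unitary_group N"

abbreviation pair_eval :: "nat \<Rightarrow> word \<Rightarrow> complex mat \<times> complex mat \<Rightarrow> complex mat" where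
  "pair_eval N w x \<equiv> word_eval N (fst x) (snd x) w"

abbreviation pair_trace :: "nat \<Rightarrow> word \<Rightarrow> complex mat \<times> complex mat \<Rightarrow> complex" where
  "pair_trace N w x \<equiv> word_trace N (fst x) (snd x) w"

lemma pair_eval_carrier: "x \<in> unitary_pairs N \<Longrightarrow> pair_eval N w x \<in> carrier_mat N N"
  using word_eval_unitary unitary_groupD(1) by (metis mem_Times_iff)

lemma pair_eval_append:
  "x \<in> unitary_pairs N \<Longrightarrow> pair_eval N (u @ v) x = pair_eval N u x * pair_eval N v x"
  using word_eval_append by (metis mem_Times_iff)

lemma pair_eval_cancel:
  assumes "x \<in> unitary_pairs N"
  shows "pair_eval N (u @ inv_word u) x = 1\<^sub>m N"
proof -
  have "pair_eval N (u @ inv_word u) x = pair_eval N u x * mat_adjoint (pair_eval N u x)"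
    using assms word_eval_inv_word by (subst pair_eval_append) (auto simp: mem_Times_iff)
  then show ?thesis using assms word_eval_unitary unitary_groupD(2) by (metis mem_Times_iff)
qed

lemma pair_trace_conv_sum:
  "x \<in> unitary_pairs N \<Longrightarrow> pair_trace N w x = (\<Sum>i<N. pair_eval N w x $$ (i, i))"
  by (simp add: word_trace_def mat_trace_conv_sum[OF pair_eval_carrier])

lemma pair_trace_append_commute:
  "x \<in> unitary_pairs N \<Longrightarrow> pair_trace N (u @ v) x = pair_trace N (v @ u) x"
  unfolding word_trace_def
  by (simp add: pair_eval_append mat_trace_mult_commute[of _ N] pair_eval_carrier)

lemma pair_trace_rotate: "x \<in> unitary_pairs N \<Longrightarrow> pair_trace N (rotate n w) x = pair_trace N w x"
  unfolding rotate_drop_take by (subst pair_trace_append_commute) auto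

lemma pair_trace_inv_word:
  assumes "x \<in> unitary_pairs N"
  shows "pair_trace N (inv_word w) x = cnj (pair_trace N w x)"
proof -
  have "pair_eval N (inv_word w) x = mat_adjoint (pair_eval N w x)"
    using assms word_eval_inv_word by (auto simp: mem_Times_iff)
  then show ?thesis using pair_eval_carrier[OF assms, of w]
    by (auto simp: word_trace_def mat_trace_conv_sum[of _ N] mat_adjoint_index)
qed

lemma pair_trace_cancel_inverse: 
  assumes "x \<in> unitary_pairs N"
  shows "pair_trace N (u @ inv_word u) x = of_nat N"
  by (simp add: word_trace_def pair_eval_cancel[OF assms] mat_trace_def)

lemma pair_trace_Nil: "pair_trace N [] x = of_nat N"
  by (simp add: word_trace_def mat_trace_def)

lemma pair_eval_cancel_middle:
  assumes "x \<in> unitary_pairs N"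
  shows "pair_eval N (a @ [l, inv_letter l] @ b) x = pair_eval N (a @ b) x"
proof -
  have "pair_eval N [l, inv_letter l] x = 1\<^sub>m N"
    using pair_eval_cancel[OF assms, of "[l]"] by simp
  then show ?thesis
    using assms left_mult_one_mat[OF pair_eval_carrier[OF assms, of b]]
    by (simp only: pair_eval_append)
qed

lemma pair_trace_cyclic_reduction:
  assumes "x \<in> unitary_pairs N" "reduced w"
  shows "pair_trace N (cyclic_reduction w) x = pair_trace N w x"
  using assms(2)
proof (induction "length w" arbitrary: w rule: less_induct)
  case less
  show ?case
  proof (cases "w = []")
    case False
    with less.prems show ?thesis
    proof (cases rule: cyclic_reduction_cases)
      case (2 l u)
      have "pair_trace N w x = pair_trace N (u @ [l, inv_letter l] @ []) x"
        using pair_trace_append_commute[OF assms(1), of "[inv_letter l]" "u @ [l]"] 2 by simp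
      also have "\<dots> = pair_trace N u x"
        unfolding word_trace_def pair_eval_cancel_middle[OF assms(1)] by simp
      finally show ?thesis using 2 less.hyps[of u] by simp
    qed simp
  qed simp
qed

lemma pair_trace_bound:
  assumes "x \<in> unitary_pairs N"
  shows "cmod (pair_trace N w x) \<le> real N"
proof -
  have "cmod (pair_trace N w x) \<le> (\<Sum>i<N. cmod (pair_eval N w x $$ (i, i)))"
    unfolding pair_trace_conv_sum[OF assms] by (rule norm_sum)
  also have "\<dots> \<le> (\<Sum>i<N. 1)"
    using assms word_eval_unitary by (intro sum_mono unitary_entry_le_1) (auto simp: mem_Times_iff)
  finally show ?thesis by simp
qed

section \<open>Infinitesimal invariance of Haar measure\<close>

definition is_projection :: "nat \<Rightarrow> complex mat \<Rightarrow> bool" where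
  "is_projection N Q \<longleftrightarrow> Q \<in> carrier_mat N N \<and>
     (\<forall>i<N. \<forall>j<N. (\<Sum>k<N. Q $$ (i, k) * Q $$ (k, j)) = Q $$ (i, j) \<and> Q $$ (j, i) = cnj (Q $$ (i, j)))"

lemma is_projectionD:
  assumes "is_projection N Q"
  shows "i < N \<Longrightarrow> j < N \<Longrightarrow> (\<Sum>k<N. Q $$ (i, k) * Q $$ (k, j)) = Q $$ (i, j)"
    and "i < N \<Longrightarrow> j < N \<Longrightarrow> cnj (Q $$ (i, j)) = Q $$ (j, i)"
  using assms by (metis is_projection_def)+

text \<open>The one-parameter unitary group \<open>exp (i t Q)\<close> generated by a projection \<open>Q\<close>; in this case
  the exponential series collapses to \<open>1 + (exp (i t) - 1) Q\<close>.\<close>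

definition projection_flow :: "nat \<Rightarrow> complex mat \<Rightarrow> real \<Rightarrow> complex mat" where
  "projection_flow N Q t =
     mat N N (\<lambda>(i, j). (if i = j then 1 else 0) + (cis t - 1) * Q $$ (i, j))"

lemma projection_flow_carrier [simp]: "projection_flow N Q t \<in> carrier_mat N N"
  by (simp add: projection_flow_def)

lemma projection_flow_dim [simp]:
  "dim_row (projection_flow N Q t) = N" "dim_col (projection_flow N Q t) = N"
  by (simp_all add: projection_flow_def)

lemma projection_flow_0 [simp]: "projection_flow N Q 0 = 1\<^sub>m N"
  by (intro eq_matI) (auto simp: projection_flow_def)

lemma projection_flow_mult_entry:
  assumes "A \<in> carrier_mat N N" "i < N" "j < N"
  shows "(projection_flow N Q t * A) $$ (i, j) = A $$ (i, j) + (cis t - 1) * (\<Sum>k<N. Q $$ (i, k) * A $$ (k, j))"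
proof -
  have "(projection_flow N Q t * A) $$ (i, j) =
      (\<Sum>k<N. ((if i = k then 1 else 0) + (cis t - 1) * Q $$ (i, k)) * A $$ (k, j))"
    using assms by (subst index_mult_mat_sum[of _ N N _ N]) (auto simp: projection_flow_def)
  also have "\<dots> = (\<Sum>k<N. (if i = k then A $$ (k, j) else 0) + (cis t - 1) * (Q $$ (i, k) * A $$ (k, j)))"
    by (intro sum.cong) (auto simp: algebra_simps)
  also have "\<dots> = A $$ (i, j) + (cis t - 1) * (\<Sum>k<N. Q $$ (i, k) * A $$ (k, j))"
    using assms by (simp add: sum.distrib sum_distrib_left)
  finally show ?thesis .
qed

lemma projection_flow_adjoint:
  assumes "is_projection N Q"
  shows "mat_adjoint (projection_flow N Q t) = projection_flow N Q (- t)"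
  by (intro eq_matI)
    (auto simp: mat_adjoint_index is_projectionD[OF assms] projection_flow_def cis_cnj)

lemma projection_flow_inverse:
  assumes "is_projection N Q"
  shows "projection_flow N Q t * projection_flow N Q (- t) = 1\<^sub>m N"
proof (intro eq_matI)
  fix i j assume ij: "i < dim_row (1\<^sub>m N :: complex mat)" "j < dim_col (1\<^sub>m N :: complex mat)"
  have *: "(\<Sum>k<N. Q $$ (i, k) * projection_flow N Q (-t) $$ (k, j)) = cis (-t) * Q $$ (i, j)"
  proof -
    have "(\<Sum>k<N. Q $$ (i, k) * projection_flow N Q (-t) $$ (k, j)) =
        (\<Sum>k<N. (if k = j then Q $$ (i, k) else 0) + (cis (-t) - 1) * (Q $$ (i, k) * Q $$ (k, j)))"
      using ij by (intro sum.cong) (auto simp: projection_flow_def algebra_simps)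
    also have "\<dots> = Q $$ (i, j) + (cis (-t) - 1) * Q $$ (i, j)"
      using ij by (simp add: sum.distrib sum_distrib_left[symmetric] is_projectionD[OF assms])
    finally show ?thesis by (simp add: algebra_simps)
  qed
  have "cis t * cis (-t) = 1" by (simp add: cis_mult)
  then show "(projection_flow N Q t * projection_flow N Q (- t)) $$ (i, j) = 1\<^sub>m N $$ (i, j)"
    using ij unfolding projection_flow_mult_entry[OF projection_flow_carrier ij[simplified]] *
    by (simp add: projection_flow_def algebra_simps)
qed auto

lemma projection_flow_unitary:
  assumes "is_projection N Q"
  shows "projection_flow N Q t \<in> unitary_group N"
  using projection_flow_inverse[OF assms, of t] projection_flow_inverse[OF assms, of "-t"]
  by (simp add: unitary_group_def projection_flow_adjoint[OF assms])

definition generator_value :: "gen \<Rightarrow> complex mat \<times> complex mat \<Rightarrow> complex mat" where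
  "generator_value g x = (case g of GenA \<Rightarrow> fst x | GenB \<Rightarrow> snd x)"

definition translate :: "gen \<Rightarrow> complex mat \<Rightarrow> complex mat \<times> complex mat \<Rightarrow> complex mat \<times> complex mat" where
  "translate g G x = (case g of GenA \<Rightarrow> (G * fst x, snd x) | GenB \<Rightarrow> (fst x, G * snd x))"

lemma letter_eval_generator_value:
  "letter_eval (fst x) (snd x) l =
     (if snd l then generator_value (fst l) x else mat_adjoint (generator_value (fst l) x))"
  by (cases "(fst x, snd x, l)" rule: letter_eval.cases) (auto simp: generator_value_def)

lemma generator_value_unitary: "x \<in> unitary_pairs N \<Longrightarrow> generator_value g x \<in> unitary_group N"
  by (auto simp: generator_value_def split: gen.splits)

lemma generator_value_translate:
  "generator_value h (translate g G x) =
     (if h = g then G * generator_value h x else generator_value h x)"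
  by (auto simp: generator_value_def translate_def split: gen.splits)

lemma translate_unitary:
  "G \<in> unitary_group N \<Longrightarrow> x \<in> unitary_pairs N \<Longrightarrow> translate g G x \<in> unitary_pairs N"
  by (auto simp: translate_def intro: unitary_group_mult split: gen.splits)

lemma translate_one: "x \<in> unitary_pairs N \<Longrightarrow> translate g (1\<^sub>m N) x = x"
  by (auto simp: translate_def left_mult_one_mat[of _ N N] unitary_groupD split: gen.splits)

lemma difference_quotient_sequence:
  fixes f :: "real \<Rightarrow> complex"
  assumes "(f has_vector_derivative D) (at 0)"
  shows "(\<lambda>n. (f (1 / real (Suc n)) - f 0) * of_nat (Suc n)) \<longlonglongrightarrow> D"
proof -
  have "((\<lambda>h. norm (f (0 + h) - f 0 - h *\<^sub>R D) / norm h) \<longlongrightarrow> 0) (at 0)"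
    using assms unfolding has_vector_derivative_def has_derivative_at by auto
  moreover have "filterlim (\<lambda>n. 1 / real (Suc n)) (at 0) sequentially"
    unfolding filterlim_at using LIMSEQ_Suc[OF lim_1_over_n[where 'a=real]] by (auto simp: eventually_sequentially)
  ultimately have "(\<lambda>n. norm (f (0 + 1 / real (Suc n)) - f 0 - (1 / real (Suc n)) *\<^sub>R D) / norm (1 / real (Suc n))) \<longlonglongrightarrow> 0"
    by (rule filterlim_compose)
  moreover have "norm (f (0 + 1 / real (Suc n)) - f 0 - (1 / real (Suc n)) *\<^sub>R D) / norm (1 / real (Suc n))
      = norm ((f (1 / real (Suc n)) - f 0) * of_nat (Suc n) - D)" (is "?l = ?r") for n
  proof -
    have "?l = norm ((f (0 + 1 / real (Suc n)) - f 0 - (1 / real (Suc n)) *\<^sub>R D)) * norm (complex_of_nat (Suc n))"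
      by (simp only: norm_of_nat norm_divide norm_one divide_divide_eq_right div_by_1 real_norm_def abs_of_nat times_divide_eq_right mult_1_right)
         (simp add: divide_inverse)
    also have "\<dots> = norm ((f (0 + 1 / real (Suc n)) - f 0 - (1 / real (Suc n)) *\<^sub>R D) * of_nat (Suc n))"
      by (rule norm_mult[symmetric])
    also have "(f (0 + 1 / real (Suc n)) - f 0 - (1 / real (Suc n)) *\<^sub>R D) * of_nat (Suc n)
        = (f (1 / real (Suc n)) - f 0) * of_nat (Suc n) - D"
      by (simp add: scaleR_conv_of_real field_simps del: of_nat_Suc)
    finally show ?thesis .
  qed
  ultimately have "(\<lambda>n. norm ((f (1 / real (Suc n)) - f 0) * of_nat (Suc n) - D)) \<longlonglongrightarrow> 0"
    by simp
  then show ?thesis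
    by (rule LIM_zero_cancel[OF tendsto_norm_zero_cancel])
qed

text \<open>A sesquilinear form is determined by its quadratic form: for \<open>v = e\<^sub>a + u e\<^sub>b\<close>, averaging \<open>u\<close>
  times the value at \<open>v\<close> over the fourth roots of unity \<open>u\<close> isolates the coefficient \<open>L a b\<close>.\<close>

lemma polarization:
  fixes L :: "nat \<Rightarrow> nat \<Rightarrow> complex"
  assumes "\<And>v :: nat \<Rightarrow> complex. (\<Sum>r<N. \<Sum>s<N. v r * cnj (v s) * L r s) = 0" "a < N" "b < N"
  shows "L a b = 0"
proof -
  have *: "L a a + cnj u * L a b + u * L b a + u * cnj u * L b b = 0" for u
  proof -
    let ?d = "\<lambda>x y :: nat. if x = y then 1 else 0 :: complex"
    have "0 = (\<Sum>r<N. \<Sum>s<N. (?d r a + u * ?d r b) * cnj (?d s a + u * ?d s b) * L r s)"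
      using assms(1)[of "\<lambda>r. ?d r a + u * ?d r b"] by simp
    also have "\<dots> = (\<Sum>r<N. (?d r a + u * ?d r b) * (\<Sum>s<N. ?d s a * L r s + cnj u * (?d s b * L r s)))"
      unfolding sum_distrib_left by (intro sum.cong) (auto simp: algebra_simps)
    also have "\<dots> = (\<Sum>r<N. (?d r a + u * ?d r b) * (L r a + cnj u * L r b))"
      using assms(2,3)
      by (simp add: sum.distrib sum_distrib_left[symmetric] if_distrib[where f="\<lambda>x. x * _"] cong: if_cong)
    also have "\<dots> = (\<Sum>r<N. ?d r a * (L r a + cnj u * L r b) + u * (?d r b * (L r a + cnj u * L r b)))"
      by (intro sum.cong) (auto simp: algebra_simps)
    also have "\<dots> = L a a + cnj u * L a b + u * (L b a + cnj u * L b b)"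
      using assms(2,3)
      by (simp add: sum.distrib sum_distrib_left[symmetric] if_distrib[where f="\<lambda>x. x * _"] cong: if_cong)
    finally show ?thesis by (simp add: algebra_simps)
  qed
  (* The combination of the relations for u = 1, -1, i, -i with coefficients 1, -1, i, -i. *)
  have "4 * L a b = (L a a + cnj 1 * L a b + 1 * L b a + 1 * cnj 1 * L b b)
     - (L a a + cnj (-1) * L a b + (-1) * L b a + (-1) * cnj (-1) * L b b)
     + \<i> * (L a a + cnj \<i> * L a b + \<i> * L b a + \<i> * cnj \<i> * L b b)
     - \<i> * (L a a + cnj (-\<i>) * L a b + (-\<i>) * L b a + (-\<i>) * cnj (-\<i>) * L b b)"
    by (simp add: algebra_simps)
  then show ?thesis unfolding * by simp
qed

lemma is_projection_rank_one:
  fixes v :: "nat \<Rightarrow> complex"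
  assumes "(\<Sum>k<N. v k * cnj (v k)) = c" "c \<noteq> 0"
  shows "is_projection N (mat N N (\<lambda>(r, s). v r * cnj (v s) / c))"
proof -
  have c: "cnj c = c" unfolding assms(1)[symmetric] by (simp add: mult.commute)
  have "(\<Sum>k<N. v i * cnj (v k) / c * (v k * cnj (v j) / c)) = v i * cnj (v j) / c" for i j
  proof -
    have "(\<Sum>k<N. v i * cnj (v k) / c * (v k * cnj (v j) / c))
        = v i * cnj (v j) / (c * c) * (\<Sum>k<N. v k * cnj (v k))"
      unfolding sum_distrib_left by (intro sum.cong) auto
    then show ?thesis using assms by simp
  qed
  then show ?thesis by (auto simp: is_projection_def c)
qed

lemma borel_measurable_cnj:
  assumes "f \<in> borel_measurable M"
  shows "(\<lambda>x. cnj (f x)) \<in> borel_measurable M"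
  using measurable_compose[OF assms borel_measurable_continuous_onI[of cnj]]
  by (auto intro!: continuous_intros)

locale haar_unitary =
  fixes N :: nat and m :: "complex mat measure"
  assumes is_haar: "is_haar_unitary N m"
begin

lemma prob_space_haar: "prob_space m"
  using is_haar by (simp add: is_haar_unitary_def)

sublocale pair_prob_space m m
  using prob_space_haar by (simp add: pair_prob_space_def pair_sigma_finite_def prob_space_imp_sigma_finite)

abbreviation haar_pair :: "(complex mat \<times> complex mat) measure" where
  "haar_pair \<equiv> m \<Otimes>\<^sub>M m"

lemma sets_haar: "sets m = sets (unitary_borel N)"
  using is_haar by (simp add: is_haar_unitary_def)

lemma space_haar: "space m = unitary_group N"
  using sets_eq_imp_space_eq[OF sets_haar] by (simp add: unitary_borel_def)

lemma space_haar_pair: "space haar_pair = unitary_pairs N"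
  by (simp add: space_pair_measure space_haar)

lemma measurable_entry:
  assumes "i < N" "j < N"
  shows "(\<lambda>U. U $$ (i, j)) \<in> borel_measurable m"
proof -
  have "(\<lambda>U. \<lambda>ij\<in>{..<N} \<times> {..<N}. U $$ ij) \<in> unitary_borel N \<rightarrow>\<^sub>M Pi\<^sub>M ({..<N} \<times> {..<N}) (\<lambda>_. borel)"
    unfolding unitary_borel_def by (rule measurable_vimage_algebra1) (auto simp: space_PiM)
  then have "(\<lambda>U. (\<lambda>ij\<in>{..<N} \<times> {..<N}. U $$ ij) (i, j)) \<in> unitary_borel N \<rightarrow>\<^sub>M borel"
    by (rule measurable_compose[OF _ measurable_component_singleton]) (use assms in auto)
  then show ?thesis
    using assms by (simp add: measurable_cong_sets[OF sets_haar refl])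
qed

lemma measurable_left_mult:
  assumes "G \<in> unitary_group N"
  shows "(\<lambda>U. G * U) \<in> m \<rightarrow>\<^sub>M m"
proof -
  have "(\<lambda>U. \<lambda>ij\<in>{..<N} \<times> {..<N}. (G * U) $$ ij) \<in> m \<rightarrow>\<^sub>M Pi\<^sub>M ({..<N} \<times> {..<N}) (\<lambda>_. borel)"
  proof (rule measurable_restrict)
    fix ij assume ij: "ij \<in> {..<N} \<times> {..<N}"
    have "(\<lambda>U. \<Sum>k<N. G $$ (fst ij, k) * U $$ (k, snd ij)) \<in> borel_measurable m"
      using ij by (intro borel_measurable_sum borel_measurable_times measurable_const measurable_entry) auto
    moreover have "(G * U) $$ ij = (\<Sum>k<N. G $$ (fst ij, k) * U $$ (k, snd ij))" if "U \<in> space m" for U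
    proof -
      have "(G * U) $$ (fst ij, snd ij) = (\<Sum>k<N. G $$ (fst ij, k) * U $$ (k, snd ij))"
        using ij unitary_groupD(1)[OF assms] that unitary_groupD(1)
        by (intro index_mult_mat_sum[of _ N N _ N]) (auto simp: space_haar)
      then show ?thesis by simp
    qed
    ultimately show "(\<lambda>U. (G * U) $$ ij) \<in> borel_measurable m"
      by (subst measurable_cong) auto
  qed
  then have "(\<lambda>U. G * U) \<in> m \<rightarrow>\<^sub>M unitary_borel N"
    unfolding unitary_borel_def
    by (intro measurable_vimage_algebra2) (auto simp: space_haar intro: unitary_group_mult assms)
  then show ?thesis by (simp add: measurable_cong_sets[OF refl sets_haar])
qed

lemma measurable_translate:
  assumes "G \<in> unitary_group N"
  shows "translate g G \<in> haar_pair \<rightarrow>\<^sub>M haar_pair"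
proof -
  note [measurable] = measurable_left_mult[OF assms]
  show ?thesis
    by (cases g) (simp_all add: translate_def[abs_def])
qed

lemma distr_translate:
  assumes "G \<in> unitary_group N"
  shows "distr haar_pair haar_pair (translate g G) = haar_pair"
proof -
  note [measurable] = measurable_left_mult[OF assms]
  have G: "distr m m (\<lambda>U. G * U) = m"
    using is_haar assms by (simp add: is_haar_unitary_def)
  have id: "distr m m (\<lambda>U. U) = m"
    by (rule distr_id)
  have "distr m m (\<lambda>U. G * U) \<Otimes>\<^sub>M distr m m (\<lambda>U. U) = distr haar_pair haar_pair (\<lambda>(U, V). (G * U, V))"
    by (rule pair_measure_distr) (auto simp: id intro: prob_space_imp_sigma_finite prob_space_haar)
  moreover have "distr m m (\<lambda>U. U) \<Otimes>\<^sub>M distr m m (\<lambda>U. G * U) = distr haar_pair haar_pair (\<lambda>(U, V). (U, G * V))"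
    by (rule pair_measure_distr) (auto simp: G intro: prob_space_imp_sigma_finite prob_space_haar)
  ultimately show ?thesis
    unfolding G id by (cases g) (simp_all add: translate_def[abs_def] case_prod_beta')
qed

lemma integral_translate:
  fixes f :: "complex mat \<times> complex mat \<Rightarrow> complex"
  assumes "G \<in> unitary_group N" "f \<in> borel_measurable haar_pair"
  shows "(\<integral>x. f (translate g G x) \<partial>haar_pair) = (\<integral>x. f x \<partial>haar_pair)"
  using integral_distr[OF measurable_translate[OF assms(1)] assms(2), of g]
  by (simp add: distr_translate[OF assms(1)])

definition bounded_measurable :: "(complex mat \<times> complex mat \<Rightarrow> complex) \<Rightarrow> bool" where
  "bounded_measurable f \<longleftrightarrow> f \<in> borel_measurable haar_pair \<and> (\<exists>C. \<forall>x\<in>unitary_pairs N. cmod (f x) \<le> C)"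

lemma bounded_measurable_const: "bounded_measurable (\<lambda>_. c)"
  by (auto simp: bounded_measurable_def)

lemma bounded_measurable_add:
  assumes "bounded_measurable f" "bounded_measurable h"
  shows "bounded_measurable (\<lambda>x. f x + h x)"
proof -
  obtain C D where "\<forall>x\<in>unitary_pairs N. cmod (f x) \<le> C" "\<forall>x\<in>unitary_pairs N. cmod (h x) \<le> D"
    using assms by (auto simp: bounded_measurable_def)
  then have "\<forall>x\<in>unitary_pairs N. cmod (f x + h x) \<le> C + D"
    by (meson add_mono norm_triangle_ineq order_trans)
  moreover have "(\<lambda>x. f x + h x) \<in> borel_measurable haar_pair"
    using assms by (intro borel_measurable_add) (auto simp: bounded_measurable_def)
  ultimately show ?thesis unfolding bounded_measurable_def by blast
qed

lemma bounded_measurable_mult: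
  assumes "bounded_measurable f" "bounded_measurable h"
  shows "bounded_measurable (\<lambda>x. f x * h x)"
proof -
  obtain C D where "\<forall>x\<in>unitary_pairs N. cmod (f x) \<le> C" "\<forall>x\<in>unitary_pairs N. cmod (h x) \<le> D"
    using assms by (auto simp: bounded_measurable_def)
  then have "cmod (f x) * cmod (h x) \<le> \<bar>C\<bar> * \<bar>D\<bar>" if "x \<in> unitary_pairs N" for x
    using that by (intro mult_mono) (auto intro: order_trans[OF _ abs_ge_self])
  then have "\<forall>x\<in>unitary_pairs N. cmod (f x * h x) \<le> \<bar>C\<bar> * \<bar>D\<bar>"
    by (simp add: norm_mult)
  moreover have "(\<lambda>x. f x * h x) \<in> borel_measurable haar_pair"
    using assms by (intro borel_measurable_times) (auto simp: bounded_measurable_def)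
  ultimately show ?thesis unfolding bounded_measurable_def by blast
qed

lemma bounded_measurable_cnj: "bounded_measurable f \<Longrightarrow> bounded_measurable (\<lambda>x. cnj (f x))"
  by (auto simp: bounded_measurable_def intro: borel_measurable_cnj)

lemma bounded_measurable_sum:
  "finite I \<Longrightarrow> (\<And>i. i \<in> I \<Longrightarrow> bounded_measurable (f i)) \<Longrightarrow> bounded_measurable (\<lambda>x. \<Sum>i\<in>I. f i x)"
  by (induction I rule: finite_induct) (auto intro: bounded_measurable_add bounded_measurable_const)

lemma bounded_measurable_integrable:
  assumes "bounded_measurable f"
  shows "integrable haar_pair f"
proof -
  obtain C where "\<forall>x\<in>unitary_pairs N. cmod (f x) \<le> C"
    using assms by (auto simp: bounded_measurable_def)
  then show ?thesis using assms
    by (intro P.integrable_const_bound[where B=C] AE_I2) (auto simp: bounded_measurable_def space_haar_pair)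
qed

lemma integral_double_sum:
  fixes f :: "nat \<Rightarrow> nat \<Rightarrow> complex mat \<times> complex mat \<Rightarrow> complex"
  assumes "\<And>i j. i < N \<Longrightarrow> j < N \<Longrightarrow> integrable haar_pair (f i j)"
  shows "(\<integral>x. (\<Sum>i<N. \<Sum>j<N. f i j x) \<partial>haar_pair) = (\<Sum>i<N. \<Sum>j<N. \<integral>x. f i j x \<partial>haar_pair)"
proof -
  have "(\<integral>x. (\<Sum>i<N. \<Sum>j<N. f i j x) \<partial>haar_pair) = (\<Sum>i<N. \<integral>x. (\<Sum>j<N. f i j x) \<partial>haar_pair)"
    using assms by (intro Bochner_Integration.integral_sum Bochner_Integration.integrable_sum) auto
  also have "\<dots> = (\<Sum>i<N. \<Sum>j<N. \<integral>x. f i j x \<partial>haar_pair)"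
    using assms by (intro sum.cong refl Bochner_Integration.integral_sum) auto
  finally show ?thesis .
qed

text \<open>\<open>D x a b\<close> is the derivative of \<open>F\<close> at \<open>x\<close> when the generator \<open>g\<close> is infinitesimally translated
  from the left by the matrix unit with indices \<open>a\<close> and \<open>b\<close>. A matrix unit is not tangent to the
  unitary group, therefore the condition speaks of the directions \<open>\<i> Q\<close> with a projection \<open>Q\<close>, whose
  flows are explicit and whose complex linear combinations are all matrices.\<close>

definition translation_derivative ::
  "gen \<Rightarrow> (complex mat \<times> complex mat \<Rightarrow> complex) \<Rightarrow> (complex mat \<times> complex mat \<Rightarrow> nat \<Rightarrow> nat \<Rightarrow> complex) \<Rightarrow> bool" where
  "translation_derivative g F D \<longleftrightarrow> bounded_measurable F
     \<and> (\<forall>a<N. \<forall>b<N. bounded_measurable (\<lambda>x. D x a b))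
     \<and> (\<forall>Q x t. is_projection N Q \<longrightarrow> x \<in> unitary_pairs N \<longrightarrow>
          ((\<lambda>t. F (translate g (projection_flow N Q t) x)) has_vector_derivative
             \<i> * (\<Sum>a<N. \<Sum>b<N. Q $$ (a, b) * D (translate g (projection_flow N Q t) x) a b)) (at t))"

lemma bounded_measurable_cong:
  assumes "\<And>x. x \<in> unitary_pairs N \<Longrightarrow> f x = h x"
  shows "bounded_measurable f \<longleftrightarrow> bounded_measurable h"
proof -
  have "f \<in> borel_measurable haar_pair \<longleftrightarrow> h \<in> borel_measurable haar_pair"
    using assms by (intro measurable_cong) (auto simp: space_haar_pair)
  then show ?thesis using assms by (simp add: bounded_measurable_def)
qed

lemma translation_derivative_cong:
  assumes "translation_derivative g F D"
    and "\<And>x. x \<in> unitary_pairs N \<Longrightarrow> F' x = F x"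
    and "\<And>x a b. x \<in> unitary_pairs N \<Longrightarrow> a < N \<Longrightarrow> b < N \<Longrightarrow> D' x a b = D x a b"
  shows "translation_derivative g F' D'"
  unfolding translation_derivative_def
proof (intro conjI allI impI)
  show "bounded_measurable F'"
    using assms(1) bounded_measurable_cong[OF assms(2)] by (simp add: translation_derivative_def)
  fix a b assume "a < N" "b < N"
  then show "bounded_measurable (\<lambda>x. D' x a b)"
    using assms(1) bounded_measurable_cong[OF assms(3)] by (simp add: translation_derivative_def)
next
  fix Q x t assume *: "is_projection N Q" "x \<in> unitary_pairs N"
  note u = translate_unitary[OF projection_flow_unitary[OF *(1)] *(2)]
  show "((\<lambda>t. F' (translate g (projection_flow N Q t) x)) has_vector_derivative
             \<i> * (\<Sum>a<N. \<Sum>b<N. Q $$ (a, b) * D' (translate g (projection_flow N Q t) x) a b)) (at t)"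
    using assms(1)[unfolded translation_derivative_def] *
    by (simp add: assms(2,3)[OF u] del: split_paired_All)
qed

lemma translation_derivative_const: "translation_derivative g (\<lambda>_. c) (\<lambda>_ _ _. 0)"
  by (simp add: translation_derivative_def bounded_measurable_const)

lemma translation_derivative_add:
  assumes "translation_derivative g F D" "translation_derivative g F' D'"
  shows "translation_derivative g (\<lambda>x. F x + F' x) (\<lambda>x a b. D x a b + D' x a b)"
  unfolding translation_derivative_def
proof (intro conjI allI impI)
  fix Q x t assume *: "is_projection N Q" "x \<in> unitary_pairs N"
  show "((\<lambda>t. F (translate g (projection_flow N Q t) x) + F' (translate g (projection_flow N Q t) x)) has_vector_derivative
             \<i> * (\<Sum>a<N. \<Sum>b<N. Q $$ (a, b) * (D (translate g (projection_flow N Q t) x) a b + D' (translate g (projection_flow N Q t) x) a b))) (at t)"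
    using assms * unfolding translation_derivative_def distrib_left sum.distrib
    by (intro has_vector_derivative_add) auto
qed (use assms in \<open>auto simp: translation_derivative_def intro: bounded_measurable_add\<close>)

lemma translation_derivative_sum:
  "finite I \<Longrightarrow> (\<And>i. i \<in> I \<Longrightarrow> translation_derivative g (F i) (D i)) \<Longrightarrow>
     translation_derivative g (\<lambda>x. \<Sum>i\<in>I. F i x) (\<lambda>x a b. \<Sum>i\<in>I. D i x a b)"
  by (induction I rule: finite_induct)
     (auto intro: translation_derivative_add translation_derivative_const)

lemma translation_derivative_mult:
  assumes "translation_derivative g F D" "translation_derivative g F' D'"
  shows "translation_derivative g (\<lambda>x. F x * F' x) (\<lambda>x a b. D x a b * F' x + F x * D' x a b)"
  unfolding translation_derivative_def
proof (intro conjI allI impI)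
  fix Q x t assume *: "is_projection N Q" "x \<in> unitary_pairs N"
  let ?y = "\<lambda>t. translate g (projection_flow N Q t) x"
  have "((\<lambda>t. F (?y t) * F' (?y t)) has_vector_derivative
      F (?y t) * (\<i> * (\<Sum>a<N. \<Sum>b<N. Q $$ (a, b) * D' (?y t) a b)) +
      (\<i> * (\<Sum>a<N. \<Sum>b<N. Q $$ (a, b) * D (?y t) a b)) * F' (?y t)) (at t)"
    using assms * unfolding translation_derivative_def
    by (intro has_vector_derivative_mult) auto
  also have "F (?y t) * (\<i> * (\<Sum>a<N. \<Sum>b<N. Q $$ (a, b) * D' (?y t) a b)) +
      (\<i> * (\<Sum>a<N. \<Sum>b<N. Q $$ (a, b) * D (?y t) a b)) * F' (?y t)
     = \<i> * (\<Sum>a<N. \<Sum>b<N. Q $$ (a, b) * (D (?y t) a b * F' (?y t) + F (?y t) * D' (?y t) a b))"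
    by (simp add: sum_distrib_left sum_distrib_right sum.distrib algebra_simps)
  finally show "((\<lambda>t. F (?y t) * F' (?y t)) has_vector_derivative
     \<i> * (\<Sum>a<N. \<Sum>b<N. Q $$ (a, b) * (D (?y t) a b * F' (?y t) + F (?y t) * D' (?y t) a b))) (at t)" .
qed (use assms in \<open>auto simp: translation_derivative_def intro!: bounded_measurable_add bounded_measurable_mult\<close>)

lemma translation_derivative_cnj:
  assumes "translation_derivative g F D"
  shows "translation_derivative g (\<lambda>x. cnj (F x)) (\<lambda>x a b. - cnj (D x b a))"
  unfolding translation_derivative_def
proof (intro conjI allI impI)
  fix a b assume "a < N" "b < N"
  then have "bounded_measurable (\<lambda>x. (-1) * cnj (D x b a))"
    using assms by (intro bounded_measurable_mult bounded_measurable_cnj bounded_measurable_const)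
      (auto simp: translation_derivative_def)
  then show "bounded_measurable (\<lambda>x. - cnj (D x b a))" by simp
next
  fix Q x t assume *: "is_projection N Q" "x \<in> unitary_pairs N"
  let ?y = "\<lambda>t. translate g (projection_flow N Q t) x"
  have "((\<lambda>t. cnj (F (?y t))) has_vector_derivative
      cnj (\<i> * (\<Sum>a<N. \<Sum>b<N. Q $$ (a, b) * D (?y t) a b))) (at t)"
    using assms * unfolding translation_derivative_def by (intro has_vector_derivative_cnj) auto
  also have "cnj (\<i> * (\<Sum>a<N. \<Sum>b<N. Q $$ (a, b) * D (?y t) a b)) =
      \<i> * (\<Sum>a<N. \<Sum>b<N. cnj (Q $$ (a, b)) * - cnj (D (?y t) a b))"
    by (simp add: sum_negf)
  also have "\<dots> = \<i> * (\<Sum>a<N. \<Sum>b<N. Q $$ (b, a) * - cnj (D (?y t) a b))"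
    using * by (intro arg_cong[where f="\<lambda>x. \<i> * x"] sum.cong refl) (simp add: is_projectionD)
  also have "(\<Sum>a<N. \<Sum>b<N. Q $$ (b, a) * - cnj (D (?y t) a b)) =
      (\<Sum>a<N. \<Sum>b<N. Q $$ (a, b) * - cnj (D (?y t) b a))"
    by (rule sum.swap)
  finally show "((\<lambda>t. cnj (F (?y t))) has_vector_derivative
      \<i> * (\<Sum>a<N. \<Sum>b<N. Q $$ (a, b) * - cnj (D (?y t) b a))) (at t)" .
qed (use assms in \<open>auto simp: translation_derivative_def intro: bounded_measurable_cnj\<close>)

text \<open>The expectation of \<open>F\<close> is constant along each flow, by invariance of Haar measure, and the
  derivative may be taken under the integral, since the difference quotients are bounded by the
  mean value theorem.\<close>

lemma integral_translation_derivative_projection: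
  assumes "translation_derivative g F D" "is_projection N Q"
  shows "(\<Sum>a<N. \<Sum>b<N. Q $$ (a, b) * (\<integral>x. D x a b \<partial>haar_pair)) = 0"
proof -
  define E where "E = (\<lambda>x. \<i> * (\<Sum>a<N. \<Sum>b<N. Q $$ (a, b) * D x a b))"
  define y where "y = (\<lambda>x t. translate g (projection_flow N Q t) x)"
  have F: "bounded_measurable F" and D: "\<And>a b. a < N \<Longrightarrow> b < N \<Longrightarrow> bounded_measurable (\<lambda>x. D x a b)"
    using assms(1) by (auto simp: translation_derivative_def)
  have der: "((\<lambda>t. F (y x t)) has_vector_derivative E (y x t)) (at t)" if "x \<in> unitary_pairs N" for x t
    using assms that unfolding translation_derivative_def E_def y_def by auto
  have y: "y x t \<in> unitary_pairs N" if "x \<in> unitary_pairs N" for x t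
    unfolding y_def by (intro translate_unitary projection_flow_unitary assms that)
  have y0: "y x 0 = x" if "x \<in> unitary_pairs N" for x
    using that by (simp add: y_def translate_one)
  have E: "bounded_measurable E"
    unfolding E_def
    by (intro bounded_measurable_mult bounded_measurable_const bounded_measurable_sum D) auto
  then obtain C where C: "\<And>x. x \<in> unitary_pairs N \<Longrightarrow> cmod (E x) \<le> C"
    by (auto simp: bounded_measurable_def)
  define q where "q = (\<lambda>n x. (F (y x (1 / real (Suc n))) - F x) * of_nat (Suc n))"
  have [measurable]: "F \<in> borel_measurable haar_pair" "(\<lambda>x. F (y x t)) \<in> borel_measurable haar_pair" for t
    using F measurable_compose[OF measurable_translate[OF projection_flow_unitary[OF assms(2)]]]
    by (auto simp: bounded_measurable_def y_def)
  have lim: "(\<lambda>n. q n x) \<longlonglongrightarrow> E x" if "x \<in> unitary_pairs N" for x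
    using difference_quotient_sequence[OF der[OF that, of 0]] by (simp add: q_def y0[OF that])
  (* The derivative deviates by at most 2 C from its value at 0, which is itself bounded by C. *)
  have bound: "cmod (q n x) \<le> 3 * C" if x: "x \<in> unitary_pairs N" for n x
  proof -
    let ?t = "1 / real (Suc n)"
    have "norm (F (y x ?t) - F (y x 0) - (?t - 0) *\<^sub>R E (y x 0)) \<le> norm (?t - 0) * (2 * C)"
    proof (rule vector_differentiable_bound_linearization)
      fix s :: real
      show "((\<lambda>t. F (y x t)) has_vector_derivative E (y x s)) (at s within UNIV)"
        using der[OF x] .
      show "norm (E (y x s) - E (y x 0)) \<le> 2 * C"
        using norm_triangle_ineq4[of "E (y x s)" "E (y x 0)"] C[OF y[OF x, of s]] C[OF y[OF x, of 0]] by linarith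
    qed auto
    moreover have "norm ((?t - 0) *\<^sub>R E (y x 0)) \<le> ?t * C"
      using C[OF y[OF x, of 0]] by (simp add: divide_right_mono)
    moreover have "norm (F (y x ?t) - F x) \<le>
        norm ((?t - 0) *\<^sub>R E (y x 0)) + norm (F (y x ?t) - F (y x 0) - (?t - 0) *\<^sub>R E (y x 0))"
      unfolding y0[OF x] by (rule norm_triangle_sub)
    ultimately have "norm (F (y x ?t) - F x) \<le> ?t * C + norm (?t - 0) * (2 * C)"
      by linarith
    also have "norm (?t - 0) = ?t" by simp
    also have "?t * C + ?t * (2 * C) = ?t * (3 * C)"
      unfolding distrib_left[symmetric] by simp
    finally have "norm (F (y x ?t) - F x) \<le> ?t * (3 * C)" .
    then show ?thesis
      unfolding q_def norm_mult norm_of_nat by (simp add: field_simps del: of_nat_Suc)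
  qed
  have "(\<lambda>n. \<integral>x. q n x \<partial>haar_pair) \<longlonglongrightarrow> (\<integral>x. E x \<partial>haar_pair)"
  proof (rule integral_dominated_convergence[where w="\<lambda>_. 3 * C"])
    show "q n \<in> borel_measurable haar_pair" for n
      unfolding q_def by measurable
  qed (use E lim bound in \<open>auto simp: bounded_measurable_def space_haar_pair intro!: AE_I2\<close>)
  moreover have "(\<integral>x. q n x \<partial>haar_pair) = 0" for n
  proof -
    let ?y = "\<lambda>x. y x (1 / real (Suc n))"
    have "bounded_measurable (\<lambda>x. F (?y x))"
    proof -
      obtain B where "\<forall>z\<in>unitary_pairs N. cmod (F z) \<le> B"
        using F unfolding bounded_measurable_def by blast
      then have "\<forall>x\<in>unitary_pairs N. cmod (F (?y x)) \<le> B"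
        using y by blast
      then show ?thesis
        unfolding bounded_measurable_def by (intro conjI exI) measurable
    qed
    then have "(\<integral>x. q n x \<partial>haar_pair) = ((\<integral>x. F (?y x) \<partial>haar_pair) - (\<integral>x. F x \<partial>haar_pair)) * of_nat (Suc n)"
      using F bounded_measurable_integrable unfolding q_def by simp
    also have "(\<integral>x. F (?y x) \<partial>haar_pair) = (\<integral>x. F x \<partial>haar_pair)"
      unfolding y_def by (intro integral_translate projection_flow_unitary assms) simp
    finally show ?thesis by simp
  qed
  ultimately have "(\<integral>x. E x \<partial>haar_pair) = 0"
    by (simp add: LIMSEQ_const_iff)
  also have "(\<integral>x. E x \<partial>haar_pair) = \<i> * (\<Sum>a<N. \<Sum>b<N. Q $$ (a, b) * (\<integral>x. D x a b \<partial>haar_pair))"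
    unfolding E_def using D bounded_measurable_integrable
    by (simp add: integral_double_sum)
  finally show ?thesis by simp
qed

lemma integral_translation_derivative:
  assumes "translation_derivative g F D" "a < N" "b < N"
  shows "(\<integral>x. D x a b \<partial>haar_pair) = 0"
proof (rule polarization[OF _ assms(2,3)])
  fix v :: "nat \<Rightarrow> complex"
  define c where "c = (\<Sum>k<N. v k * cnj (v k))"
  show "(\<Sum>r<N. \<Sum>s<N. v r * cnj (v s) * (\<integral>x. D x r s \<partial>haar_pair)) = 0"
  proof (cases "c = 0")
    case True
    have "c = of_real (\<Sum>k<N. (cmod (v k))\<^sup>2)"
      by (simp add: c_def complex_norm_square[symmetric])
    then have "(\<Sum>k<N. (cmod (v k))\<^sup>2) = 0"
      using True of_real_eq_0_iff by metis
    then have "v k = 0" if "k < N" for k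
      using that by (simp add: sum_nonneg_eq_0_iff)
    then show ?thesis by simp
  next
    case False
    let ?Q = "mat N N (\<lambda>(r, s). v r * cnj (v s) / c)"
    have "(\<Sum>a<N. \<Sum>b<N. ?Q $$ (a, b) * (\<integral>x. D x a b \<partial>haar_pair)) = 0"
      by (intro integral_translation_derivative_projection[OF assms(1)] is_projection_rank_one)
         (use False in \<open>auto simp: c_def\<close>)
    also have "(\<Sum>a<N. \<Sum>b<N. ?Q $$ (a, b) * (\<integral>x. D x a b \<partial>haar_pair))
        = (\<Sum>r<N. \<Sum>s<N. v r * cnj (v s) * (\<integral>x. D x r s \<partial>haar_pair)) / c"
      by (simp add: sum_divide_distrib)
    finally show ?thesis using False by simp
  qed
qed

end

section \<open>Derivatives of words and the loop equation\<close>

text \<open>An infinitesimal translation of the generator \<open>g\<close> by \<open>X\<close> changes \<open>g\<close> by \<open>X g\<close> and its inverse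
  by \<open>- g\<inverse> X\<close>. So at each occurrence of the generator, \<open>X\<close> is inserted with a sign, just before or
  just after the letter; the cut position is the place of this insertion.\<close>

definition letter_sign :: "gen \<Rightarrow> letter \<Rightarrow> complex" where
  "letter_sign g l = (if fst l \<noteq> g then 0 else if snd l then 1 else - 1)"

definition cut_position :: "word \<Rightarrow> nat \<Rightarrow> nat" where
  "cut_position w k = (if snd (w ! k) then k else Suc k)"

lemma cut_position_Cons_0: "cut_position (l # w) 0 = (if snd l then 0 else 1)"
  and cut_position_Cons_Suc: "cut_position (l # w) (Suc k) = Suc (cut_position w k)"
  by (simp_all add: cut_position_def)

lemma cut_position_le: "k < length w \<Longrightarrow> cut_position w k \<le> length w"
  by (simp add: cut_position_def)

definition entry_derivative ::
  "nat \<Rightarrow> gen \<Rightarrow> word \<Rightarrow> nat \<Rightarrow> nat \<Rightarrow> complex mat \<times> complex mat \<Rightarrow> nat \<Rightarrow> nat \<Rightarrow> complex" where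
  "entry_derivative N g w i j x a b = (\<Sum>k<length w. letter_sign g (w ! k) *
     (pair_eval N (take (cut_position w k) w) x $$ (i, a) * pair_eval N (drop (cut_position w k) w) x $$ (b, j)))"

definition trace_derivative ::
  "nat \<Rightarrow> gen \<Rightarrow> word \<Rightarrow> complex mat \<times> complex mat \<Rightarrow> nat \<Rightarrow> nat \<Rightarrow> complex" where
  "trace_derivative N g w x a b = (\<Sum>k<length w. letter_sign g (w ! k) *
     pair_eval N (rotate (cut_position w k) w) x $$ (b, a))"

lemma pair_eval_append_entry:
  assumes "x \<in> unitary_pairs N" "i < N" "j < N"
  shows "pair_eval N (u @ v) x $$ (i, j) = (\<Sum>l<N. pair_eval N u x $$ (i, l) * pair_eval N v x $$ (l, j))"
  unfolding pair_eval_append[OF assms(1)]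
  by (rule index_mult_mat_sum[OF pair_eval_carrier pair_eval_carrier]) (use assms in auto)

lemma entry_derivative_Cons:
  assumes "x \<in> unitary_pairs N" "i < N" "j < N" "a < N" "b < N"
  shows "entry_derivative N g (l # w) i j x a b =
    (\<Sum>r<N. entry_derivative N g [l] i r x a b * pair_eval N w x $$ (r, j)
          + pair_eval N [l] x $$ (i, r) * entry_derivative N g w r j x a b)"
proof -
  let ?c = "if snd l then 0 else 1"
  have "entry_derivative N g (l # w) i j x a b =
      letter_sign g l * (pair_eval N (take ?c [l]) x $$ (i, a) * pair_eval N (drop ?c [l] @ w) x $$ (b, j))
      + (\<Sum>k<length w. letter_sign g (w ! k) * (pair_eval N ([l] @ take (cut_position w k) w) x $$ (i, a)
          * pair_eval N (drop (cut_position w k) w) x $$ (b, j)))"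
    unfolding entry_derivative_def
    by (simp add: sum.lessThan_Suc_shift cut_position_Cons_0 cut_position_Cons_Suc del: sum.lessThan_Suc)
  also have "letter_sign g l * (pair_eval N (take ?c [l]) x $$ (i, a) * pair_eval N (drop ?c [l] @ w) x $$ (b, j))
      = (\<Sum>r<N. letter_sign g l * (pair_eval N (take ?c [l]) x $$ (i, a) * pair_eval N (drop ?c [l]) x $$ (b, r))
           * pair_eval N w x $$ (r, j))"
    using assms by (simp only: pair_eval_append_entry sum_distrib_left mult.assoc)
  also have "(\<Sum>k<length w. letter_sign g (w ! k) * (pair_eval N ([l] @ take (cut_position w k) w) x $$ (i, a)
          * pair_eval N (drop (cut_position w k) w) x $$ (b, j)))
      = (\<Sum>k<length w. \<Sum>r<N. pair_eval N [l] x $$ (i, r) * (letter_sign g (w ! k) *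
          (pair_eval N (take (cut_position w k) w) x $$ (r, a) * pair_eval N (drop (cut_position w k) w) x $$ (b, j))))"
    using assms
    by (simp only: pair_eval_append_entry sum_distrib_left sum_distrib_right mult.assoc mult.left_commute)
  also have "\<dots> = (\<Sum>r<N. pair_eval N [l] x $$ (i, r) * entry_derivative N g w r j x a b)"
    unfolding entry_derivative_def sum_distrib_left by (rule sum.swap)
  finally show ?thesis
    by (simp add: entry_derivative_def sum.distrib cut_position_Cons_0)
qed

context haar_unitary
begin

lemma translation_derivative_generator:
  assumes "i < N" "j < N"
  shows "translation_derivative g (\<lambda>x. generator_value h x $$ (i, j))
    (\<lambda>x a b. if h = g \<and> i = a then generator_value h x $$ (b, j) else 0)"
  unfolding translation_derivative_def
proof (intro conjI allI impI)
  have bm: "bounded_measurable (\<lambda>x. generator_value h x $$ (i, j))" if "i < N" "j < N" for i j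
  proof -
    note [measurable] = measurable_entry[OF that]
    have "(\<lambda>x. generator_value h x $$ (i, j)) \<in> borel_measurable haar_pair"
      by (cases h) (simp_all add: generator_value_def)
    then show ?thesis
      using unitary_entry_le_1[OF generator_value_unitary that] unfolding bounded_measurable_def by blast
  qed
  show "bounded_measurable (\<lambda>x. generator_value h x $$ (i, j))"
    by (rule bm) fact+
  show "bounded_measurable (\<lambda>x. if h = g \<and> i = a then generator_value h x $$ (b, j) else 0)"
    if "a < N" "b < N" for a b
    using bm[of b j] that assms
    by (cases "h = g \<and> i = a") (auto intro: bounded_measurable_const)
next
  fix Q x t assume Q: "is_projection N Q" and x: "x \<in> unitary_pairs N"
  let ?A = "generator_value h x" and ?G = "\<lambda>t. projection_flow N Q t"
  have A: "?A \<in> carrier_mat N N"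
    using unitary_groupD(1)[OF generator_value_unitary[OF x]] .
  show "((\<lambda>t. generator_value h (translate g (?G t) x) $$ (i, j)) has_vector_derivative
     \<i> * (\<Sum>a<N. \<Sum>b<N. Q $$ (a, b) *
        (if h = g \<and> i = a then generator_value h (translate g (?G t) x) $$ (b, j) else 0))) (at t)"
  proof (cases "h = g")
    case True
    define s where "s = (\<Sum>k<N. Q $$ (i, k) * ?A $$ (k, j))"
    have "(\<Sum>b<N. Q $$ (i, b) * (?G t * ?A) $$ (b, j)) =
        (\<Sum>b<N. Q $$ (i, b) * ?A $$ (b, j)) + (cis t - 1) * (\<Sum>b<N. \<Sum>k<N. Q $$ (i, b) * Q $$ (b, k) * ?A $$ (k, j))"
      using assms by (simp add: projection_flow_mult_entry[OF A] algebra_simps sum.distrib sum_distrib_left sum_subtractf)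
    also have "(\<Sum>b<N. \<Sum>k<N. Q $$ (i, b) * Q $$ (b, k) * ?A $$ (k, j)) =
        (\<Sum>k<N. (\<Sum>b<N. Q $$ (i, b) * Q $$ (b, k)) * ?A $$ (k, j))"
      unfolding sum_distrib_right by (rule sum.swap)
    also have "\<dots> = s"
      unfolding s_def using assms is_projectionD(1)[OF Q] by (intro sum.cong) auto
    finally have *: "(\<Sum>b<N. Q $$ (i, b) * (?G t * ?A) $$ (b, j)) = cis t * s"
      by (simp add: s_def algebra_simps)
    have "((\<lambda>t. ?A $$ (i, j) + (cis t - 1) * s) has_vector_derivative \<i> * (cis t * s)) (at t)"
    proof -
      have "(cis has_vector_derivative \<i> * cis t) (at t)"
        unfolding has_vector_derivative_complex_iff
        by (auto intro!: derivative_eq_intros)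
      then have "((\<lambda>t. ?A $$ (i, j) + (cis t - 1) * s) has_vector_derivative 0 + (\<i> * cis t - 0) * s) (at t)"
        by (intro has_vector_derivative_add has_vector_derivative_const has_vector_derivative_mult_left
            has_vector_derivative_diff)
      then show ?thesis by (simp add: mult.assoc)
    qed
    then have "((\<lambda>t. (?G t * ?A) $$ (i, j)) has_vector_derivative \<i> * (cis t * s)) (at t)"
      using assms by (simp add: projection_flow_mult_entry[OF A] s_def)
    moreover have "(\<Sum>a<N. \<Sum>b<N. Q $$ (a, b) * (if h = g \<and> i = a then (?G t * ?A) $$ (b, j) else 0))
       = (\<Sum>a<N. if i = a then (\<Sum>b<N. Q $$ (a, b) * (?G t * ?A) $$ (b, j)) else 0)"
      using True by (intro sum.cong) auto
    moreover have "generator_value h (translate g (?G t) x) = ?G t * ?A" for t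
      using True by (simp add: generator_value_translate)
    ultimately show ?thesis
      using assms(1) by (simp only: *) (simp add: *)
  qed (simp add: generator_value_translate)
qed

lemma translation_derivative_letter:
  assumes ij: "i < N" "j < N"
  shows "translation_derivative g (\<lambda>x. pair_eval N [l] x $$ (i, j)) (entry_derivative N g [l] i j)"
proof (cases "snd l")
  case True
  show ?thesis
  proof (rule translation_derivative_cong[OF translation_derivative_generator[OF ij, of g "fst l"]])
    fix x assume x: "x \<in> unitary_pairs N"
    have e: "pair_eval N [l] x = generator_value (fst l) x"
      using True unitary_groupD(1)[OF generator_value_unitary[OF x]]
      by (simp add: letter_eval_generator_value right_mult_one_mat[of _ N N])
    show "pair_eval N [l] x $$ (i, j) = generator_value (fst l) x $$ (i, j)" by (simp only: e)
    fix a b assume "a < N" "b < N"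
    then show "entry_derivative N g [l] i j x a b =
        (if fst l = g \<and> i = a then generator_value (fst l) x $$ (b, j) else 0)"
      using True ij by (simp add: entry_derivative_def cut_position_def letter_sign_def e del: word_eval_Cons)
  qed
next
  case False
  show ?thesis
  proof (rule translation_derivative_cong[OF translation_derivative_cnj[OF
        translation_derivative_generator[OF ij(2,1), of g "fst l"]]])
    fix x assume x: "x \<in> unitary_pairs N"
    note c = unitary_groupD(1)[OF generator_value_unitary[OF x], of "fst l"]
    have e: "pair_eval N [l] x $$ (r, s) = cnj (generator_value (fst l) x $$ (s, r))" if "r < N" "s < N" for r s
      using False c that
      by (simp add: letter_eval_generator_value right_mult_one_mat[of _ N N] mat_adjoint_index)
    show "pair_eval N [l] x $$ (i, j) = cnj (generator_value (fst l) x $$ (j, i))"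
      using e ij by simp
    fix a b assume "a < N" "b < N"
    then show "entry_derivative N g [l] i j x a b =
        - cnj (if fst l = g \<and> j = b then generator_value (fst l) x $$ (a, i) else 0)"
      using False ij by (simp add: entry_derivative_def cut_position_def letter_sign_def e del: word_eval_Cons)
  qed
qed

lemma translation_derivative_word:
  assumes "i < N" "j < N"
  shows "translation_derivative g (\<lambda>x. pair_eval N w x $$ (i, j)) (entry_derivative N g w i j)"
  using assms
proof (induction w arbitrary: i j)
  case Nil
  show ?case
    by (rule translation_derivative_cong[OF translation_derivative_const[of g "1\<^sub>m N $$ (i, j)"]])
       (simp_all add: entry_derivative_def)
next
  case (Cons l w)
  have "translation_derivative g (\<lambda>x. \<Sum>r<N. pair_eval N [l] x $$ (i, r) * pair_eval N w x $$ (r, j))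
     (\<lambda>x a b. \<Sum>r<N. entry_derivative N g [l] i r x a b * pair_eval N w x $$ (r, j)
          + pair_eval N [l] x $$ (i, r) * entry_derivative N g w r j x a b)"
    using Cons by (intro translation_derivative_sum translation_derivative_mult translation_derivative_letter) auto
  then show ?case
  proof (rule translation_derivative_cong)
    fix x assume "x \<in> unitary_pairs N"
    then show "pair_eval N (l # w) x $$ (i, j) = (\<Sum>r<N. pair_eval N [l] x $$ (i, r) * pair_eval N w x $$ (r, j))"
      using pair_eval_append_entry[of x N i j "[l]" w] Cons.prems by simp
  qed (rule entry_derivative_Cons, use Cons.prems in auto)
qed

lemma translation_derivative_trace:
  "translation_derivative g (pair_trace N w) (trace_derivative N g w)"
proof -
  have "translation_derivative g (\<lambda>x. \<Sum>i<N. pair_eval N w x $$ (i, i))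
     (\<lambda>x a b. \<Sum>i<N. entry_derivative N g w i i x a b)"
    by (intro translation_derivative_sum translation_derivative_word) auto
  then show ?thesis
  proof (rule translation_derivative_cong)
    fix x a b assume x: "x \<in> unitary_pairs N" and ab: "a < N" "b < N"
    have *: "rotate c w = drop c w @ take c w" if "c \<le> length w" for c
      using that by (cases "c = length w") (auto simp: rotate_drop_take)
    have "(\<Sum>i<N. entry_derivative N g w i i x a b) =
       (\<Sum>k<length w. \<Sum>i<N. letter_sign g (w ! k) *
     (pair_eval N (take (cut_position w k) w) x $$ (i, a) * pair_eval N (drop (cut_position w k) w) x $$ (b, i)))"
      unfolding entry_derivative_def by (rule sum.swap)
    also have "\<dots> = trace_derivative N g w x a b"
      unfolding trace_derivative_def using x ab
      by (intro sum.cong) (auto simp: * cut_position_le pair_eval_append_entry sum_distrib_left mult.commute mult.left_commute)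
    finally show "trace_derivative N g w x a b = (\<Sum>i<N. entry_derivative N g w i i x a b)" ..
  qed (simp add: pair_trace_conv_sum)
qed

text \<open>Moments are indexed by the multiset of their words, because the loop equation replaces words
  by new ones and removes others.\<close>

abbreviation trace_product :: "word multiset \<Rightarrow> complex mat \<times> complex mat \<Rightarrow> complex" where
  "trace_product M x \<equiv> (\<Prod>v\<in>#M. pair_trace N v x)"

lemma translation_derivative_trace_product:
  "translation_derivative g (trace_product M)
     (\<lambda>x a b. \<Sum>v\<in>#M. trace_derivative N g v x a b * trace_product (M - {#v#}) x)"
proof (induction M)
  case empty
  then show ?case using translation_derivative_const[of g 1] by simp
next
  case (add w M)
  have "translation_derivative g (\<lambda>x. pair_trace N w x * trace_product M x)
     (\<lambda>x a b. trace_derivative N g w x a b * trace_product M x + pair_trace N w x *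
        (\<Sum>v\<in>#M. trace_derivative N g v x a b * trace_product (M - {#v#}) x))"
    by (intro translation_derivative_mult translation_derivative_trace add.IH)
  then show ?case
  proof (rule translation_derivative_cong)
    fix x a b
    have eq: "(\<Sum>v\<in>#M. trace_derivative N g v x a b * trace_product (add_mset w M - {#v#}) x)
        = (\<Sum>v\<in>#M. pair_trace N w x * (trace_derivative N g v x a b * trace_product (M - {#v#}) x))"
      by (intro arg_cong[where f=sum_mset] image_mset_cong) (simp add: mult.left_commute)
    show "(\<Sum>v\<in>#add_mset w M. trace_derivative N g v x a b * trace_product (add_mset w M - {#v#}) x) =
       trace_derivative N g w x a b * trace_product M x + pair_trace N w x *
        (\<Sum>v\<in>#M. trace_derivative N g v x a b * trace_product (M - {#v#}) x)"
      by (simp only: image_mset_add_mset sum_mset.add_mset add_mset_remove_trivial eq sum_mset_distrib_left)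
  qed simp
qed

definition moment :: "word multiset \<Rightarrow> complex" where
  "moment M = (\<integral>x. trace_product M x \<partial>haar_pair)"

lemma bounded_measurable_trace_product: "bounded_measurable (trace_product M)"
  using translation_derivative_trace_product unfolding translation_derivative_def by blast

lemma integrable_trace_product [intro, simp]: "integrable haar_pair (trace_product M)"
  by (rule bounded_measurable_integrable[OF bounded_measurable_trace_product])

lemma integrable_sum_mset:
  "(\<And>v. v \<in># M \<Longrightarrow> integrable haar_pair (f v)) \<Longrightarrow> integrable haar_pair (\<lambda>x. (\<Sum>v\<in>#M. f v x) :: complex)"
  by (induction M) auto

lemma integral_sum_mset:
  "(\<And>v. v \<in># M \<Longrightarrow> integrable haar_pair (f v)) \<Longrightarrow>
     (\<integral>x. (\<Sum>v\<in>#M. f v x :: complex) \<partial>haar_pair) = (\<Sum>v\<in>#M. \<integral>x. f v x \<partial>haar_pair)"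
  by (induction M) (auto simp: integrable_sum_mset)

lemma integrable_moment_combination:
  "integrable haar_pair (\<lambda>x. \<Sum>k<n. c k * trace_product (P k) x)"
  by (intro Bochner_Integration.integrable_sum Bochner_Integration.integrable_mult_right) simp

lemma integral_moment_combination:
  "(\<integral>x. (\<Sum>k<n. c k * trace_product (P k) x) \<partial>haar_pair) = (\<Sum>k<n. c k * moment (P k))"
proof -
  have "(\<integral>x. (\<Sum>k<n. c k * trace_product (P k) x) \<partial>haar_pair)
      = (\<Sum>k<n. \<integral>x. c k * trace_product (P k) x \<partial>haar_pair)"
    by (intro Bochner_Integration.integral_sum Bochner_Integration.integrable_mult_right) simp
  then show ?thesis by (simp only: moment_def integral_mult_right_zero)
qed

text \<open>The Schwinger--Dyson equation, also known as loop equation. Take the entry \<open>(i, j)\<close> of \<open>w\<close>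
  times the traces of \<open>M\<close>, translate in the direction of the matrix unit with the same indices, and
  sum over \<open>i\<close> and \<open>j\<close>. Inserting the matrix units into \<open>w\<close> itself splits its trace into two, and
  inserting them into \<open>v\<close> joins \<open>w\<close> and a rotation of \<open>v\<close> to a single trace.\<close>

theorem schwinger_dyson:
  "(\<Sum>k<length w. letter_sign g (w ! k) *
       moment (add_mset (take (cut_position w k) w) (add_mset (drop (cut_position w k) w) M)))
   + (\<Sum>v\<in>#M. \<Sum>k<length v. letter_sign g (v ! k) *
       moment (add_mset (w @ rotate (cut_position v k) v) (M - {#v#}))) = 0" (is "?split + ?join = 0")
proof -
  define D where "D = (\<lambda>i j x a b. entry_derivative N g w i j x a b * trace_product M x
      + pair_eval N w x $$ (i, j) * (\<Sum>v\<in>#M. trace_derivative N g v x a b * trace_product (M - {#v#}) x))"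
  have td: "translation_derivative g (\<lambda>x. pair_eval N w x $$ (i, j) * trace_product M x) (D i j)"
    if "i < N" "j < N" for i j
    unfolding D_def
    by (intro translation_derivative_mult translation_derivative_word translation_derivative_trace_product that)
  have D0: "(\<integral>x. D i j x i j \<partial>haar_pair) = 0" and Dint: "integrable haar_pair (\<lambda>x. D i j x i j)"
    if "i < N" "j < N" for i j
    using integral_translation_derivative[OF td[OF that] that] td[OF that] that
      bounded_measurable_integrable[of "\<lambda>x. D i j x i j"]
    unfolding translation_derivative_def by blast+
  define S where "S = (\<lambda>x. (\<Sum>k<length w. letter_sign g (w ! k) *
       trace_product (add_mset (take (cut_position w k) w) (add_mset (drop (cut_position w k) w) M)) x)
   + (\<Sum>v\<in>#M. \<Sum>k<length v. letter_sign g (v ! k) *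
       trace_product (add_mset (w @ rotate (cut_position v k) v) (M - {#v#})) x))"
  have "(\<Sum>i<N. \<Sum>j<N. D i j x i j) = S x" if x: "x \<in> unitary_pairs N" for x
  proof -
    have "(\<Sum>i<N. \<Sum>j<N. entry_derivative N g w i j x i j) =
        (\<Sum>k<length w. \<Sum>i<N. \<Sum>j<N. letter_sign g (w ! k) *
          (pair_eval N (take (cut_position w k) w) x $$ (i, i) * pair_eval N (drop (cut_position w k) w) x $$ (j, j)))"
      unfolding entry_derivative_def by (simp only: sum.swap[of _ "{..<length w}"])
    also have "\<dots> = (\<Sum>k<length w. letter_sign g (w ! k) *
          (pair_trace N (take (cut_position w k) w) x * pair_trace N (drop (cut_position w k) w) x))"
      by (simp only: pair_trace_conv_sum[OF x] sum_product) (simp only: sum_distrib_left)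
    finally have 1: "(\<Sum>i<N. \<Sum>j<N. entry_derivative N g w i j x i j) = \<dots>" .
    have 2: "(\<Sum>i<N. \<Sum>j<N. pair_eval N w x $$ (i, j) * trace_derivative N g v x i j) =
        (\<Sum>k<length v. letter_sign g (v ! k) * pair_trace N (w @ rotate (cut_position v k) v) x)" for v
    proof -
      have "(\<Sum>i<N. \<Sum>j<N. pair_eval N w x $$ (i, j) * trace_derivative N g v x i j) =
         (\<Sum>k<length v. \<Sum>i<N. \<Sum>j<N. letter_sign g (v ! k) *
            (pair_eval N w x $$ (i, j) * pair_eval N (rotate (cut_position v k) v) x $$ (j, i)))"
        unfolding trace_derivative_def sum_distrib_left
        by (simp only: sum.swap[of _ "{..<length v}"] mult.left_commute)
      also have "\<dots> = (\<Sum>k<length v. letter_sign g (v ! k) * pair_trace N (w @ rotate (cut_position v k) v) x)"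
        by (simp add: pair_trace_conv_sum[OF x] pair_eval_append_entry[OF x] sum_distrib_left)
      finally show ?thesis .
    qed
    have "(\<Sum>i<N. \<Sum>j<N. D i j x i j) =
       (\<Sum>i<N. \<Sum>j<N. entry_derivative N g w i j x i j) * trace_product M x
       + (\<Sum>i<N. \<Sum>j<N. \<Sum>v\<in>#M. pair_eval N w x $$ (i, j) * trace_derivative N g v x i j * trace_product (M - {#v#}) x)"
      unfolding D_def by (simp only: sum.distrib sum_distrib_right sum_mset_distrib_left mult.assoc)
    also have "(\<Sum>i<N. \<Sum>j<N. \<Sum>v\<in>#M. pair_eval N w x $$ (i, j) * trace_derivative N g v x i j * trace_product (M - {#v#}) x)
      = (\<Sum>v\<in>#M. (\<Sum>i<N. \<Sum>j<N. pair_eval N w x $$ (i, j) * trace_derivative N g v x i j) * trace_product (M - {#v#}) x)"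
    proof -
      have swap: "(\<Sum>i<N. \<Sum>v\<in>#M. f i v) = (\<Sum>v\<in>#M. \<Sum>i<N. f i v)" for f :: "nat \<Rightarrow> word \<Rightarrow> complex"
        by (induction M) (auto simp: sum.distrib)
      show ?thesis by (simp add: swap sum_distrib_right)
    qed
    finally show ?thesis
      unfolding 1 2 S_def by (simp add: sum_distrib_right sum_distrib_left mult.assoc)
  qed
  then have "(\<integral>x. S x \<partial>haar_pair) = (\<integral>x. (\<Sum>i<N. \<Sum>j<N. D i j x i j) \<partial>haar_pair)"
    by (intro Bochner_Integration.integral_cong) (auto simp: space_haar_pair)
  also have "\<dots> = 0"
    using D0 Dint by (simp add: integral_double_sum)
  also have "(\<integral>x. S x \<partial>haar_pair) = ?split + ?join"
    unfolding S_def
    by (subst Bochner_Integration.integral_add)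
       (simp_all only: integral_sum_mset integrable_sum_mset integrable_moment_combination
          integral_moment_combination)
  finally show ?thesis .
qed

end

section \<open>Boundedness and recursion of moments\<close>

abbreviation nontrivial_words :: "word multiset \<Rightarrow> bool" where
  "nontrivial_words M \<equiv> \<forall>v\<in>#M. cyclically_reduced v \<and> v \<noteq> []"

definition total_length :: "word multiset \<Rightarrow> nat" where
  "total_length M = (\<Sum>v\<in>#M. length v)"

lemma total_length_simps [simp]:
  "total_length {#} = 0" "total_length (add_mset v M) = length v + total_length M"
  by (simp_all add: total_length_def)

lemma total_length_remove: "v \<in># M \<Longrightarrow> total_length M = length v + total_length (M - {#v#})"
  by (metis insert_DiffM total_length_simps(2))

lemma size_le_total_length: "nontrivial_words M \<Longrightarrow> size M \<le> total_length M"
proof (induction M)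
  case (add v M)
  then have "size M \<le> total_length M" "1 \<le> length v" by (auto simp: Suc_le_eq)
  then show ?case by simp
qed simp

text \<open>The cut at a letter falls on an end of the word only if the letter is a generator in first
  place or an inverse generator in last place. In a nonempty cyclically reduced word with positive
  seam, exactly one cut at letters of the generator concerned is trivial in this way. The inverses of
  such words are of the same kind, and every nonempty word has a rotation of this kind.\<close>

definition positive_seam :: "word \<Rightarrow> bool" where
  "positive_seam w \<longleftrightarrow> snd (hd w) \<or> \<not> snd (last w)"

definition seam_rotation :: "word \<Rightarrow> word" where
  "seam_rotation w = (if snd (hd w) then w else rotate 1 w)"

lemma positive_seam_seam_rotation: "w \<noteq> [] \<Longrightarrow> positive_seam (seam_rotation w)"
  by (cases w) (auto simp: positive_seam_def seam_rotation_def)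

lemma positive_seam_inv_word: "w \<noteq> [] \<Longrightarrow> positive_seam (inv_word w) \<longleftrightarrow> positive_seam w"
  by (auto simp: positive_seam_def hd_inv_word last_inv_word inv_letter_def)

lemma seam_rotation_rotate: "seam_rotation w = rotate (if snd (hd w) then 0 else 1) w"
  by (simp add: seam_rotation_def)

text \<open>Generator, sign and index of the letter with the trivial cut.\<close>

definition seam_generator :: "word \<Rightarrow> gen" where
  "seam_generator w = (if snd (hd w) then fst (hd w) else fst (last w))"

definition seam_sign :: "word \<Rightarrow> complex" where
  "seam_sign w = (if snd (hd w) then 1 else - 1)"

definition seam_index :: "word \<Rightarrow> nat" where
  "seam_index w = (if snd (hd w) then 0 else length w - 1)"

lemma seam_index_less: "w \<noteq> [] \<Longrightarrow> seam_index w < length w"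
  by (simp add: seam_index_def)

lemma seam_index:
  assumes "w \<noteq> []" "positive_seam w"
  shows "letter_sign (seam_generator w) (w ! seam_index w) = seam_sign w"
    and "cut_position w (seam_index w) = 0 \<or> cut_position w (seam_index w) = length w"
  using assms
  by (auto simp: letter_sign_def seam_generator_def seam_index_def seam_sign_def positive_seam_def
      cut_position_def hd_conv_nth last_conv_nth)

lemma nontrivial_cut:
  assumes w: "cyclically_reduced w" "w \<noteq> []" "positive_seam w"
    and k: "k < length w" "k \<noteq> seam_index w" "letter_sign (seam_generator w) (w ! k) \<noteq> 0"
  shows "0 < cut_position w k" "cut_position w k < length w"
proof -
  let ?g = "seam_generator w"
  have g: "fst (w ! k) = ?g" using k by (auto simp: letter_sign_def split: if_splits)
  have hl: "hd w \<noteq> inv_letter (last w)" using w by (auto simp: cyclically_reduced_def)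
  show "0 < cut_position w k"
  proof (rule ccontr)
    assume "\<not> 0 < cut_position w k"
    then have "k = 0" "snd (w ! 0)" by (auto simp: cut_position_def split: if_splits)
    then show False using k w by (simp add: seam_index_def hd_conv_nth)
  qed
  show "cut_position w k < length w"
  proof (rule ccontr)
    assume "\<not> cut_position w k < length w"
    then have "k = length w - 1" "\<not> snd (w ! k)" using k by (auto simp: cut_position_def split: if_splits)
    moreover from this have "snd (hd w)"
      using k(2) by (auto simp: seam_index_def split: if_splits)
    ultimately have "last w = (?g, False)" "snd (hd w)"
      using w(2) g by (simp_all add: last_conv_nth prod_eq_iff)
    then have "hd w = inv_letter (last w)"
      by (auto simp: seam_generator_def inv_letter_def prod_eq_iff)
    with hl show False by simp
  qed
qed

text \<open>A rotation of \<open>v\<close> that is inverse to \<open>w\<close> has the inverse of the seam letter of \<open>w\<close> at its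
  own cut, and therefore carries the opposite sign. The letter at the other end of the rotation gives
  no second contribution, since \<open>w\<close> is cyclically reduced.\<close>

lemma trivial_gluings:
  assumes w: "cyclically_reduced w" "w \<noteq> []" "positive_seam w"
  shows "(\<Sum>k<length v. letter_sign (seam_generator w) (v ! k) *
      (if rotate (cut_position v k) v = inv_word w then 1 else 0)) = - seam_sign w * of_nat (matchings w v)"
proof -
  let ?g = "seam_generator w"
  have hl: "hd w \<noteq> inv_letter (last w)" using w by (auto simp: cyclically_reduced_def)
  have hd_rot: "hd (rotate k v) = v ! k" if "k < length v" for k
    using that by (subst hd_rotate_conv_nth) auto
  have last_rot: "last (rotate (Suc k) v) = v ! k" if "k < length v" for k
  proof -
    have "rotate k v \<noteq> []" using that by auto
    then have "last (rotate1 (rotate k v)) = hd (rotate k v)" by (cases "rotate k v") auto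
    then show ?thesis using hd_rot[OF that] by simp
  qed
  show ?thesis
  proof (cases "snd (hd w)")
    case True
    then have hdw: "hd w = (?g, True)" by (simp add: seam_generator_def prod_eq_iff)
    have "letter_sign ?g (v ! k) * (if rotate (cut_position v k) v = inv_word w then 1 else 0)
        = - (if rotate (Suc k) v = inv_word w then 1 else 0)" if k: "k < length v" for k
    proof (cases "rotate (Suc k) v = inv_word w")
      case True
      then have "v ! k = inv_letter (hd w)" using last_rot[OF k] last_inv_word[OF w(2)] by simp
      then have "v ! k = (?g, False)" using hdw by (simp add: inv_letter_def)
      then show ?thesis using True by (simp add: letter_sign_def cut_position_def del: rotate_Suc)
    next
      case False
      have "rotate k v \<noteq> inv_word w" if "v ! k = (?g, True)"
      proof
        assume "rotate k v = inv_word w"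
        then have "inv_letter (last w) = (?g, True)" using hd_rot[OF k] hd_inv_word[OF w(2)] that by simp
        with hl hdw show False by simp
      qed
      then show ?thesis using False
        by (auto simp: letter_sign_def cut_position_def prod_eq_iff simp del: rotate_Suc)
    qed
    then show ?thesis
      using True by (simp add: matchings_conv_sum_Suc seam_sign_def sum_negf del: rotate_Suc)
  next
    case False
    then have lastw: "last w = (?g, False)" using w by (simp add: seam_generator_def positive_seam_def prod_eq_iff)
    have "letter_sign ?g (v ! k) * (if rotate (cut_position v k) v = inv_word w then 1 else 0)
        = (if rotate k v = inv_word w then 1 else 0)" if k: "k < length v" for k
    proof (cases "rotate k v = inv_word w")
      case True
      then have "v ! k = inv_letter (last w)" using hd_rot[OF k] hd_inv_word[OF w(2)] by simp
      then have "v ! k = (?g, True)" using lastw by (simp add: inv_letter_def)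
      then show ?thesis using True by (simp add: letter_sign_def cut_position_def)
    next
      case F: False
      have "rotate (Suc k) v \<noteq> inv_word w" if "v ! k = (?g, False)"
      proof
        assume "rotate (Suc k) v = inv_word w"
        then have "inv_letter (hd w) = (?g, False)" using last_rot[OF k] last_inv_word[OF w(2)] that by simp
        then have "snd (hd w)" by (auto simp: inv_letter_def)
        with False show False by simp
      qed
      then show ?thesis using F
        by (auto simp: letter_sign_def cut_position_def prod_eq_iff simp del: rotate_Suc)
    qed
    then show ?thesis
      using False by (simp add: matchings_conv_sum seam_sign_def)
  qed
qed

lemma norm_letter_sign_mult_le: "cmod z \<le> B \<Longrightarrow> cmod (letter_sign g l * z) \<le> B"
  using order_trans[OF norm_ge_zero[of z]] by (auto simp: letter_sign_def)

lemma norm_sum_mset_le: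
  "(\<And>v. v \<in># M \<Longrightarrow> cmod (f v) \<le> h v) \<Longrightarrow> cmod (\<Sum>v\<in>#M. f v) \<le> (\<Sum>v\<in>#M. h v)"
  by (induction M) (auto intro: norm_triangle_mono)

context haar_unitary
begin

lemma moment_cong:
  assumes "\<And>x. x \<in> unitary_pairs N \<Longrightarrow> trace_product M x = trace_product M' x"
  shows "moment M = moment M'"
  unfolding moment_def using assms by (intro Bochner_Integration.integral_cong) (auto simp: space_haar_pair)

lemma moment_empty [simp]: "moment {#} = 1"
  by (simp add: moment_def P.prob_space)

lemma moment_add_cong:
  "(\<And>x. x \<in> unitary_pairs N \<Longrightarrow> pair_trace N u x = pair_trace N v x) \<Longrightarrow>
     moment (add_mset u M) = moment (add_mset v M)"
  by (rule moment_cong) simp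

lemma moment_add_trivial:
  assumes "\<And>x. x \<in> unitary_pairs N \<Longrightarrow> pair_trace N u x = of_nat N"
  shows "moment (add_mset u M) = of_nat N * moment M"
proof -
  have "moment (add_mset u M) = (\<integral>x. of_nat N * trace_product M x \<partial>haar_pair)"
    unfolding moment_def using assms
    by (intro Bochner_Integration.integral_cong) (auto simp: space_haar_pair)
  then show ?thesis by (simp add: moment_def)
qed

lemma norm_moment_le: "cmod (moment M) \<le> real N ^ size M"
proof -
  have *: "cmod (trace_product M x) \<le> real N ^ size M" if "x \<in> unitary_pairs N" for x
    by (induction M) (auto simp: norm_mult intro!: mult_mono pair_trace_bound[OF that])
  have "cmod (moment M) \<le> (\<integral>x. cmod (trace_product M x) \<partial>haar_pair)"
    unfolding moment_def by (rule integral_norm_bound)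
  also have "\<dots> \<le> (\<integral>x. real N ^ size M \<partial>haar_pair)"
    using * by (intro integral_mono integrable_norm integrable_trace_product) (auto simp: space_haar_pair)
  finally show ?thesis by (simp add: P.prob_space)
qed

text \<open>The loop equation, solved for its dominant terms. A trivial word contributes a factor
  \<open>tr 1 = N\<close>; by the choice of the seam, this happens for exactly one of the splittings and, among
  the joinings, exactly for the matchings. The remaining terms, at most one for each letter, are
  moments of nontrivial words whose total length has not grown.\<close>

lemma dominant_terms:
  assumes w: "cyclically_reduced w" "w \<noteq> []" "positive_seam w"
    and M: "nontrivial_words M" and L: "length w + total_length M \<le> L"
    and B: "\<And>M'. nontrivial_words M' \<Longrightarrow> total_length M' \<le> L \<Longrightarrow> cmod (moment M') \<le> B"
  shows "real N * cmod (moment (add_mset w M) - (\<Sum>v\<in>#M. of_nat (matchings w v) * moment (M - {#v#})))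
     \<le> real L * B"
proof -
  let ?g = "seam_generator w" and ?s = "seam_sign w" and ?k = "seam_index w"
  have B_reduced: "cmod (moment (add_mset u M')) \<le> B"
    if "reduced u" "u \<noteq> []" "nontrivial_words M'" "length u + total_length M' \<le> L" for u M'
  proof -
    note r = cyclically_reduced_cyclic_reduction[OF that(1,2)]
    have "moment (add_mset u M') = moment (add_mset (cyclic_reduction u) M')"
      by (rule moment_add_cong) (simp add: pair_trace_cyclic_reduction that)
    then show ?thesis using B[of "add_mset (cyclic_reduction u) M'"] r that by simp
  qed
  have B0: "0 \<le> B" using order_trans[OF norm_ge_zero B[of "{#}"]] by simp
  have rw: "reduced w" using w by (simp add: cyclically_reduced_def)

  (* triv selects the joinings that cancel completely; they are of order N, the others are bounded. *)
  define split where "split = (\<lambda>k. letter_sign ?g (w ! k) *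
       moment (add_mset (take (cut_position w k) w) (add_mset (drop (cut_position w k) w) M)))"
  define join where "join = (\<lambda>v k. letter_sign ?g (v ! k) *
       moment (add_mset (w @ rotate (cut_position v k) v) (M - {#v#})))"
  define triv where "triv = (\<lambda>v k. if rotate (cut_position v k) v = inv_word w then 1 else 0 :: complex)"
  define rest where "rest = (\<lambda>v k. (1 - triv v k) * join v k)"

  have split_seam: "split ?k = ?s * (of_nat N * moment (add_mset w M))"
  proof -
    have "moment (add_mset (take (cut_position w ?k) w) (add_mset (drop (cut_position w ?k) w) M)) =
       of_nat N * moment (add_mset w M)"
      using seam_index(2)[OF w(2,3)]
    proof
      assume "cut_position w ?k = 0"
      then show ?thesis by (simp add: moment_add_trivial pair_trace_Nil)
    next
      assume "cut_position w ?k = length w"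
      then show ?thesis
        by (simp add: add_mset_commute[of w "[]"] moment_add_trivial pair_trace_Nil)
    qed
    then show ?thesis by (simp add: split_def seam_index(1)[OF w(2,3)])
  qed
  have split_rest: "cmod (split k) \<le> B" if k: "k < length w" "k \<noteq> ?k" for k
  proof (cases "letter_sign ?g (w ! k) = 0")
    case True
    then show ?thesis using B0 by (simp add: split_def)
  next
    case False
    let ?c = "cut_position w k"
    have c: "0 < ?c" "?c < length w" using nontrivial_cut[OF w k False] by auto
    let ?u = "cyclic_reduction (drop ?c w)"
    have "reduced (drop ?c w)" "drop ?c w \<noteq> []" using c rw by (auto simp: reduced_drop)
    note u = cyclically_reduced_cyclic_reduction[OF this]
    have "moment (add_mset (take ?c w) (add_mset (drop ?c w) M)) = moment (add_mset (take ?c w) (add_mset ?u M))"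
      using c rw by (intro moment_cong) (simp add: pair_trace_cyclic_reduction reduced_drop)
    also have "cmod \<dots> \<le> B"
      using c rw M L u by (intro B_reduced) (auto simp: reduced_take)
    finally show ?thesis
      unfolding split_def by (rule norm_letter_sign_mult_le)
  qed
  have join_rest: "cmod (rest v k) \<le> B" if v: "v \<in># M" "k < length v" for v k
  proof (cases "rotate (cut_position v k) v = inv_word w")
    case True
    then show ?thesis using B0 by (simp add: rest_def triv_def)
  next
    case False
    let ?r = "rotate (cut_position v k) v"
    have cv: "cyclically_reduced ?r" using v M by simp
    have "\<exists>r. reduced r \<and> r \<noteq> [] \<and> length r \<le> length w + length ?r
       \<and> (\<lambda>x\<in>unitary_pairs N. pair_eval N r x) = (\<lambda>x\<in>unitary_pairs N. pair_eval N (w @ ?r) x)"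
      using cv rw False
      by (intro reduce_product) (auto simp: cyclically_reduced_def intro!: restrict_ext pair_eval_cancel_middle[simplified])
    then obtain r where r: "reduced r" "r \<noteq> []" "length r \<le> length w + length v"
      and eq_fun: "(\<lambda>x\<in>unitary_pairs N. pair_eval N r x) = (\<lambda>x\<in>unitary_pairs N. pair_eval N (w @ ?r) x)"
      by auto
    have eq: "pair_eval N r x = pair_eval N (w @ ?r) x" if "x \<in> unitary_pairs N" for x
      using fun_cong[OF eq_fun, of x] that by (simp only: restrict_apply')
    have "moment (add_mset (w @ ?r) (M - {#v#})) = moment (add_mset r (M - {#v#}))"
      by (rule moment_add_cong) (simp add: word_trace_def eq)
    also have "cmod \<dots> \<le> B"
      using r M L total_length_remove[OF v(1)] by (intro B_reduced) (auto dest: in_diffD)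
    finally have "cmod (join v k) \<le> B"
      unfolding join_def by (rule norm_letter_sign_mult_le)
    then show ?thesis using False by (simp add: rest_def triv_def)
  qed
  have join_triv: "(\<Sum>k<length v. triv v k * join v k) =
      - ?s * (of_nat N * (of_nat (matchings w v) * moment (M - {#v#})))" for v
  proof -
    have "(\<Sum>k<length v. triv v k * join v k) =
       (\<Sum>k<length v. letter_sign ?g (v ! k) * triv v k) * (of_nat N * moment (M - {#v#}))"
      unfolding sum_distrib_right
      by (intro sum.cong refl)
         (auto simp: triv_def join_def moment_add_trivial pair_trace_cancel_inverse)
    then show ?thesis by (simp add: triv_def trivial_gluings[OF w])
  qed
  have "0 = (\<Sum>k<length w. split k) + (\<Sum>v\<in>#M. \<Sum>k<length v. join v k)"
    using schwinger_dyson[of ?g w M] by (simp add: split_def join_def)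
  also have "(\<Sum>k<length w. split k) = split ?k + (\<Sum>k\<in>{..<length w} - {?k}. split k)"
    using seam_index_less[OF w(2)] by (simp add: sum.remove)
  also have "(\<Sum>v\<in>#M. \<Sum>k<length v. join v k) =
      (\<Sum>v\<in>#M. (\<Sum>k<length v. triv v k * join v k) + (\<Sum>k<length v. rest v k))"
    unfolding sum.distrib[symmetric] rest_def by (simp add: algebra_simps)
  also have "\<dots> = - ?s * (of_nat N * (\<Sum>v\<in>#M. of_nat (matchings w v) * moment (M - {#v#})))
      + (\<Sum>v\<in>#M. \<Sum>k<length v. rest v k)"
    by (simp only: join_triv sum_mset.distrib sum_mset_distrib_left)
  finally have balance: "0 = ?s * (of_nat N * moment (add_mset w M)) + (\<Sum>k\<in>{..<length w} - {?k}. split k)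
      + (- ?s * (of_nat N * (\<Sum>v\<in>#M. of_nat (matchings w v) * moment (M - {#v#})))
         + (\<Sum>v\<in>#M. \<Sum>k<length v. rest v k))"
    unfolding split_seam .
  have solve: "s * (n * (m - S)) = - (a + b)" if "0 = s * (n * m) + a + (- s * (n * S) + b)"
    for a b s n m S :: complex
  proof -
    have "s * (n * (m - S)) + (a + b) = s * (n * m) + a + (- s * (n * S) + b)"
      by (simp add: algebra_simps)
    then have "s * (n * (m - S)) + (a + b) = 0" using that by metis
    then show ?thesis by (simp only: eq_neg_iff_add_eq_0)
  qed
  have "?s * (of_nat N * (moment (add_mset w M) - (\<Sum>v\<in>#M. of_nat (matchings w v) * moment (M - {#v#}))))
     = - ((\<Sum>k\<in>{..<length w} - {?k}. split k) + (\<Sum>v\<in>#M. \<Sum>k<length v. rest v k))" (is "?l = - (?a + ?b)")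
    by (rule solve[OF balance])
  moreover have "cmod ?a \<le> real (length w) * B"
  proof -
    have "cmod ?a \<le> (\<Sum>k\<in>{..<length w} - {?k}. B)"
      by (rule sum_norm_le) (use split_rest in auto)
    also have "\<dots> \<le> (\<Sum>k<length w. B)"
      using B0 by (intro sum_mono2) auto
    finally show ?thesis by simp
  qed
  moreover have "cmod ?b \<le> real (total_length M) * B"
  proof -
    have "cmod ?b \<le> (\<Sum>v\<in>#M. real (length v) * B)"
    proof (rule norm_sum_mset_le)
      fix v assume v: "v \<in># M"
      have "cmod (\<Sum>k<length v. rest v k) \<le> (\<Sum>k<length v. B)"
        by (rule sum_norm_le) (use join_rest[OF v] in auto)
      then show "cmod (\<Sum>k<length v. rest v k) \<le> real (length v) * B" by simp
    qed
    also have "\<dots> = real (total_length M) * B"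
      by (induction M) (auto simp: algebra_simps)
    finally show ?thesis .
  qed
  ultimately have "cmod ?l \<le> real (length w + total_length M) * B"
    using norm_triangle_ineq[of ?a ?b] by (simp only: norm_minus_cancel of_nat_add distrib_right)
  also have "\<dots> \<le> real L * B"
    using L B0 by (intro mult_right_mono) auto
  finally show ?thesis
    by (simp add: norm_mult seam_sign_def split: if_splits)
qed

lemma norm_matching_sum_le:
  assumes "nontrivial_words M" "\<And>v. v \<in># M \<Longrightarrow> cmod (moment (M - {#v#})) \<le> C"
  shows "cmod (\<Sum>v\<in>#M. of_nat (matchings w v) * moment (M - {#v#})) \<le> real (total_length M) * C"
proof -
  have "cmod (\<Sum>v\<in>#M. of_nat (matchings w v) * moment (M - {#v#})) \<le> (\<Sum>v\<in>#M. real (length v) * C)"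
  proof (rule norm_sum_mset_le)
    fix v assume "v \<in># M"
    then show "cmod (of_nat (matchings w v) * moment (M - {#v#})) \<le> real (length v) * C"
      unfolding norm_mult norm_of_nat using assms(2) matchings_le[of w v]
      by (intro mult_mono) auto
  qed
  also have "\<dots> = real (total_length M) * C"
    by (induction M) (auto simp: algebra_simps)
  finally show ?thesis .
qed

lemma moment_seam_rotation: "moment (add_mset (seam_rotation w) M) = moment (add_mset w M)"
  by (rule moment_add_cong) (simp only: seam_rotation_rotate pair_trace_rotate)

text \<open>The loop equation relates moments of the same total length, so it is not a recursion. But the
  terms that do not get shorter come with the factor \<open>1 / N\<close>: the best bound \<open>B\<close> for total length
  \<open>L + 1\<close>, which is finite since traces are bounded by \<open>N\<close>, satisfies \<open>B \<le> max 1 (B / 2 + (L + 1) C)\<close>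
  as soon as \<open>N > 2 (L + 1)\<close>, and then \<open>B\<close> can be absorbed.\<close>

lemma moment_bound_step:
  assumes N: "N > 2 * Suc L"
    and C: "\<And>M. nontrivial_words M \<Longrightarrow> total_length M \<le> L \<Longrightarrow> cmod (moment M) \<le> C"
    and M: "nontrivial_words M" "total_length M \<le> Suc L"
  shows "cmod (moment M) \<le> max 1 (2 * real (Suc L) * C)"
proof -
  define S where "S = {cmod (moment M) |M. nontrivial_words M \<and> total_length M \<le> Suc L}"
  have bdd: "bdd_above S"
  proof (rule bdd_aboveI)
    fix y assume "y \<in> S"
    then obtain M where M: "nontrivial_words M" "total_length M \<le> Suc L" "y = cmod (moment M)"
      by (auto simp: S_def)
    have "y \<le> real N ^ size M" using M norm_moment_le by simp
    also have "\<dots> \<le> real N ^ Suc L"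
      using size_le_total_length[OF M(1)] M(2) N by (intro power_increasing) auto
    finally show "y \<le> real N ^ Suc L" .
  qed
  define B where "B = Sup S"
  have B: "cmod (moment M) \<le> B" if "nontrivial_words M" "total_length M \<le> Suc L" for M
    unfolding B_def by (rule cSup_upper[OF _ bdd]) (use that in \<open>auto simp: S_def\<close>)
  have C0: "0 \<le> C" using order_trans[OF norm_ge_zero C[of "{#}"]] by simp
  have "cmod (moment M) \<le> max 1 (B / 2 + real (Suc L) * C)"
    if M: "nontrivial_words M" "total_length M \<le> Suc L" for M
  proof (cases M)
    case (add w M')
    let ?w = "seam_rotation w"
    have w: "cyclically_reduced ?w" "?w \<noteq> []" "positive_seam ?w" "length ?w = length w"
      using M add positive_seam_seam_rotation[of w] by (auto simp: seam_rotation_rotate)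
    let ?S = "\<Sum>v\<in>#M'. of_nat (matchings ?w v) * moment (M' - {#v#})"
    have "real N * cmod (moment (add_mset ?w M') - ?S) \<le> real (Suc L) * B"
      by (rule dominant_terms[OF w(1-3)]) (use M add B w in auto)
    moreover have "2 * (real (Suc L) * B) \<le> real N * B"
    proof -
      have "2 * real (Suc L) \<le> real N" using N by linarith
      from mult_right_mono[OF this order_trans[OF norm_ge_zero B[OF M]]]
      show ?thesis by (simp only: mult.assoc)
    qed
    ultimately have "real N * cmod (moment (add_mset ?w M') - ?S) \<le> real N * (B / 2)"
      by simp
    then have "cmod (moment (add_mset ?w M') - ?S) \<le> B / 2"
      using N by (subst (asm) mult_le_cancel_left_pos) auto
    moreover have "cmod ?S \<le> real (total_length M') * C"
    proof (rule norm_matching_sum_le)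
      fix v assume v: "v \<in># M'"
      have "length w > 0" "length w + total_length M' \<le> Suc L" using M add by simp_all
      then have "total_length (M' - {#v#}) \<le> L"
        using total_length_remove[OF v] by linarith
      then show "cmod (moment (M' - {#v#})) \<le> C"
        using M add by (intro C) (auto dest: in_diffD)
    qed (use M add in auto)
    moreover have "real (total_length M') * C \<le> real (Suc L) * C"
      using M add C0 by (intro mult_right_mono) auto
    ultimately have "cmod (moment (add_mset ?w M')) \<le> B / 2 + real (Suc L) * C"
      using norm_triangle_sub[of "moment (add_mset ?w M')" ?S] by linarith
    then show ?thesis using add by (simp add: moment_seam_rotation)
  qed simp
  then have "B \<le> max 1 (B / 2 + real (Suc L) * C)"
    unfolding B_def
    by (intro cSup_least) (auto simp: S_def intro!: exI[of _ "{#}"])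
  then have "B \<le> max 1 (2 * real (Suc L) * C)"
    by (auto simp: max_def algebra_simps split: if_splits)
  then show ?thesis using B[OF M] by linarith
qed

end

lemma moments_bounded:
  "\<exists>C. \<forall>N m M. N > 2 * L \<longrightarrow> is_haar_unitary N m \<longrightarrow> nontrivial_words M \<longrightarrow> total_length M \<le> L
     \<longrightarrow> cmod (haar_unitary.moment N m M) \<le> C"
proof (induction L)
  case 0
  have "cmod (haar_unitary.moment N m M) \<le> 1" if "is_haar_unitary N m" "nontrivial_words M" "total_length M \<le> 0"
    for N m M
  proof -
    interpret haar_unitary N m by unfold_locales fact
    have "M = {#}" using size_le_total_length[OF that(2)] that(3) by simp
    then show ?thesis by simp
  qed
  then show ?case by blast
next
  case (Suc L)
  then obtain C where C: "\<And>N m M. N > 2 * L \<Longrightarrow> is_haar_unitary N m \<Longrightarrow> nontrivial_words M \<Longrightarrow> total_length M \<le> L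
     \<Longrightarrow> cmod (haar_unitary.moment N m M) \<le> C" by blast
  have "cmod (haar_unitary.moment N m M) \<le> max 1 (2 * real (Suc L) * C)"
    if "N > 2 * Suc L" "is_haar_unitary N m" "nontrivial_words M" "total_length M \<le> Suc L" for N m M
  proof -
    interpret haar_unitary N m by unfold_locales fact
    show ?thesis using that C[of N m] by (intro moment_bound_step) auto
  qed
  then show ?case by blast
qed

text \<open>Now that the moments are bounded, the remaining terms of the loop equation are \<open>O(1/N)\<close>.\<close>

lemma moment_recursion:
  assumes haar: "\<And>N. is_haar_unitary N (\<mu> N)"
    and w: "cyclically_reduced w" "w \<noteq> []" "positive_seam w" and M: "nontrivial_words M"
  shows "(\<lambda>N. haar_unitary.moment N (\<mu> N) (add_mset w M)
     - (\<Sum>v\<in>#M. of_nat (matchings w v) * haar_unitary.moment N (\<mu> N) (M - {#v#}))) \<in> O(\<lambda>N. 1 / of_nat N)"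
proof -
  let ?L = "length w + total_length M"
  obtain C where C: "\<And>N m M. N > 2 * ?L \<Longrightarrow> is_haar_unitary N m \<Longrightarrow> nontrivial_words M \<Longrightarrow> total_length M \<le> ?L
     \<Longrightarrow> cmod (haar_unitary.moment N m M) \<le> C"
    using moments_bounded[of ?L] by blast
  show ?thesis
  proof (rule bigoI[where c = "real ?L * C"])
    show "eventually (\<lambda>N. norm (haar_unitary.moment N (\<mu> N) (add_mset w M)
     - (\<Sum>v\<in>#M. of_nat (matchings w v) * haar_unitary.moment N (\<mu> N) (M - {#v#})))
        \<le> real ?L * C * norm (1 / of_nat N :: complex)) at_top"
      using eventually_gt_at_top[of "2 * ?L"]
    proof eventually_elim
      case (elim N)
      interpret haar_unitary N "\<mu> N" by unfold_locales (rule haar)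
      have "real N * cmod (moment (add_mset w M) - (\<Sum>v\<in>#M. of_nat (matchings w v) * moment (M - {#v#})))
         \<le> real ?L * C"
        by (rule dominant_terms[OF w M order_refl C[OF elim haar]])
      then show ?case using elim by (simp add: norm_divide field_simps)
    qed
  qed
qed

text \<open>A Wick formula. The recursion removes factors in pairs of mutually inverse words, with
  multiplicity \<open>j\<close>. A pairing of all factors exists only if each word occurs as often as its inverse,
  and then there are \<open>\<alpha>!\<close> ways to pair the \<open>\<alpha>\<close> copies of a word with those of its inverse.\<close>

lemma moment_pairings:
  fixes u :: "nat \<times> bool \<Rightarrow> word" and j :: "nat \<Rightarrow> nat"
  assumes haar: "\<And>N. is_haar_unitary N (\<mu> N)"
    and u: "\<And>i s. i < p \<Longrightarrow> cyclically_reduced (u (i, s)) \<and> u (i, s) \<noteq> [] \<and> positive_seam (u (i, s))"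
    and match: "\<And>i s k t. i < p \<Longrightarrow> k < p \<Longrightarrow>
       matchings (u (i, s)) (u (k, t)) = (if k = i \<and> t = (\<not> s) then j i else 0)"
    and E: "set_mset E \<subseteq> {..<p} \<times> UNIV"
  shows "(\<lambda>N. haar_unitary.moment N (\<mu> N) (image_mset u E)
     - (if \<forall>i<p. count E (i, False) = count E (i, True)
        then \<Prod>i<p. fact (count E (i, True)) * of_nat (j i) ^ count E (i, True) else 0)) \<in> O(\<lambda>N. 1 / of_nat N)"
  using E
proof (induction "size E" arbitrary: E rule: less_induct)
  case less
  define T :: "(nat \<times> bool) multiset \<Rightarrow> complex" where "T = (\<lambda>E. if \<forall>i<p. count E (i, False) = count E (i, True)
        then \<Prod>i<p. fact (count E (i, True)) * of_nat (j i) ^ count E (i, True) else 0)"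
  define mom where "mom = (\<lambda>N. haar_unitary.moment N (\<mu> N))"
  have IH: "(\<lambda>N. mom N (image_mset u E') - T E') \<in> O(\<lambda>N. 1 / of_nat N)"
    if "size E' < size E" "set_mset E' \<subseteq> {..<p} \<times> UNIV" for E'
    unfolding T_def mom_def by (rule less.hyps[OF that])
  have "(\<lambda>N. mom N (image_mset u E) - T E) \<in> O(\<lambda>N. 1 / of_nat N)"
  proof (cases E)
    case empty
    have "mom N {#} = 1" for N
    proof -
      interpret haar_unitary N "\<mu> N" by unfold_locales (rule haar)
      show ?thesis by (simp add: mom_def)
    qed
    then show ?thesis by (simp add: empty T_def)
  next
    case (add x F)
    obtain i s where x: "x = (i, s)" by (cases x)
    have i: "i < p" using less.prems add x by auto
    have F: "set_mset F \<subseteq> {..<p} \<times> UNIV" using less.prems add by auto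
    let ?y = "(i, \<not> s)"
    let ?c = "of_nat (j i) * of_nat (count F ?y) :: complex"
    have eq: "(\<Sum>v\<in>#image_mset u F. of_nat (matchings (u x) v) * mom N (image_mset u F - {#v#}))
        = ?c * mom N (image_mset u (F - {#?y#}))" for N
    proof -
      have "(\<Sum>v\<in>#image_mset u F. of_nat (matchings (u x) v) * mom N (image_mset u F - {#v#})) =
        (\<Sum>z\<in>#F. of_nat (matchings (u x) (u z)) * mom N (image_mset u F - {#u z#}))"
        by (simp add: image_mset.compositionality comp_def)
      also have "\<dots> = (\<Sum>z\<in>#F. if z = ?y then of_nat (j i) * mom N (image_mset u (F - {#?y#})) else 0)"
      proof (intro arg_cong[where f=sum_mset] image_mset_cong)
        fix z assume z: "z \<in># F"
        then obtain k t where kt: "z = (k, t)" "k < p" using F by (cases z) auto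
        have "image_mset u F - {#u z#} = image_mset u (F - {#z#})"
          using z by (simp add: image_mset_Diff)
        then show "of_nat (matchings (u x) (u z)) * mom N (image_mset u F - {#u z#}) =
           (if z = ?y then of_nat (j i) * mom N (image_mset u (F - {#?y#})) else 0)"
          using match[OF i kt(2), of s t] by (auto simp: x kt(1))
      qed
      also have "\<dots> = of_nat (j i) * mom N (image_mset u (F - {#?y#})) * of_nat (count F ?y)"
        by (rule sum_mset_delta)
      finally show ?thesis by (simp add: mult.commute mult.left_commute)
    qed
    have "(\<lambda>N. mom N (add_mset (u x) (image_mset u F))
       - (\<Sum>v\<in>#image_mset u F. of_nat (matchings (u x) v) * mom N (image_mset u F - {#v#}))) \<in> O(\<lambda>N. 1 / of_nat N)"
      unfolding mom_def by (rule moment_recursion[OF haar]) (use u i x F in auto)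
    then have rec: "(\<lambda>N. mom N (image_mset u E) - ?c * mom N (image_mset u (F - {#?y#}))) \<in> O(\<lambda>N. 1 / of_nat N)"
      unfolding eq by (simp add: add)
    have "(\<lambda>N. ?c * (mom N (image_mset u (F - {#?y#})) - T (F - {#?y#}))) \<in> O(\<lambda>N. 1 / of_nat N)"
    proof -
      have "(\<lambda>N. mom N (image_mset u (F - {#?y#})) - T (F - {#?y#})) \<in> O(\<lambda>N. 1 / of_nat N)"
        using F add by (intro IH) (auto dest: in_diffD simp: size_Diff1_le le_imp_less_Suc)
      from landau_o.big.mult[OF bigo_const[of ?c] this] show ?thesis by simp
    qed
    from sum_in_bigo(1)[OF rec this]
    have "(\<lambda>N. mom N (image_mset u E) - ?c * T (F - {#?y#})) \<in> O(\<lambda>N. 1 / of_nat N)"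
      by (simp add: algebra_simps)
    moreover have "?c * T (F - {#?y#}) = T E"
    proof (cases "?y \<in># F")
      case False
      then have "count E (i, False) \<noteq> count E (i, True)"
        by (cases s) (auto simp: add x not_in_iff)
      then have "T E = 0" unfolding T_def using i by auto
      then show ?thesis using False by (simp add: not_in_iff)
    next
      case True
      define G where "G = F - {#?y#}"
      have F': "F = add_mset ?y G" using True by (simp add: G_def)
      have countE: "count E (k, t) = count G (k, t) + (if k = i then 1 else 0)" for k t
        by (cases s; cases t) (auto simp: add x F')
      have bal: "(\<forall>k<p. count E (k, False) = count E (k, True)) \<longleftrightarrow> (\<forall>k<p. count G (k, False) = count G (k, True))"
        unfolding countE by simp
      show ?thesis
      proof (cases "\<forall>k<p. count G (k, False) = count G (k, True)")
        case False
        then show ?thesis using bal by (simp only: T_def if_False mult_zero_right G_def)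
      next
        case b: True
        let ?f = "\<lambda>E k. fact (count E (k, True)) * of_nat (j k) ^ count E (k, True) :: complex"
        have n: "count F ?y = Suc (count G (i, True))"
          using b i by (cases s) (auto simp: F')
        have "T E = ?f E i * (\<Prod>k\<in>{..<p} - {i}. ?f E k)"
          using b bal i unfolding T_def by (simp add: prod.remove)
        also have "(\<Prod>k\<in>{..<p} - {i}. ?f E k) = (\<Prod>k\<in>{..<p} - {i}. ?f G k)"
          by (intro prod.cong refl) (auto simp: countE)
        also have "?f E i = ?c * ?f G i"
          unfolding n by (simp add: countE)
        also have "?c * ?f G i * (\<Prod>k\<in>{..<p} - {i}. ?f G k) = ?c * T G"
          using b i unfolding T_def by (simp add: prod.remove mult.assoc)
        finally show ?thesis by (simp only: G_def)
      qed
    qed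
    ultimately show ?thesis by simp
  qed
  then show ?case unfolding T_def mom_def .
qed

section \<open>Moments of complex Gaussians\<close>

abbreviation half_normal_density :: "real \<Rightarrow> real" where
  "half_normal_density \<equiv> normal_density 0 (1 / sqrt 2)"

text \<open>The law of the real and of the imaginary part of a standard complex Gaussian.\<close>

abbreviation half_normal :: "real measure" where
  "half_normal \<equiv> density lborel half_normal_density"

lemma half_normal_density_eq: "half_normal_density x = exp (- x\<^sup>2) / sqrt pi"
  by (simp add: normal_density_def power_divide field_simps)

lemma prob_space_half_normal: "prob_space half_normal"
  by (rule prob_space_normal_density) simp

interpretation half_normal: pair_prob_space half_normal half_normal
  using prob_space_half_normal
  by (simp add: pair_prob_space_def pair_sigma_finite_def prob_space_imp_sigma_finite)

lemma integrable_half_normal_power: "integrable half_normal (\<lambda>x. x ^ n)"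
  using integrable_normal_moment[of "1 / sqrt 2" 0 n] by (simp add: integrable_density)

text \<open>Stein's identity for monomials, read off from the known moments.\<close>

lemma half_normal_moment: "(\<integral>x. x ^ Suc n \<partial>half_normal) = real n / 2 * (\<integral>x. x ^ (n - 1) \<partial>half_normal)"
proof -
  have even: "(\<integral>x. x ^ (2 * k) \<partial>half_normal) = fact (2 * k) / (4 ^ k * fact k)" for k
    using integral_normal_moment_even[of "1 / sqrt 2" 0 k] by (simp add: integral_density power_divide)
  have odd: "(\<integral>x. x ^ (2 * k + 1) \<partial>half_normal) = 0" for k
    using integral_normal_moment_odd[of "1 / sqrt 2" 0 k] by (simp add: integral_density)
  show ?thesis
  proof (cases "even n")
    case True
    then obtain k where n: "n = 2 * k" by (elim evenE)
    show ?thesis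
    proof (cases k)
      case 0
      then show ?thesis using odd[of 0] n by simp
    next
      case (Suc l)
      then show ?thesis using odd[of k] odd[of l] n by simp
    qed
  next
    case False
    then obtain k where n: "n = 2 * k + 1" by (elim oddE)
    have f: "fact (2 * Suc k) = 2 * real (Suc k) * (real n * fact (2 * k))"
      unfolding n by (simp add: algebra_simps)
    have "fact (2 * Suc k) / (4 ^ Suc k * fact (Suc k))
       = (2 * real (Suc k) * (real n * fact (2 * k))) / (2 * real (Suc k) * (2 * (4 ^ k * fact k)))"
      unfolding f by (simp add: algebra_simps)
    also have "\<dots> = (real n * fact (2 * k)) / (2 * (4 ^ k * fact k))"
      by (rule mult_divide_mult_cancel_left) simp
    finally have "fact (2 * Suc k) / (4 ^ Suc k * fact (Suc k)) = real n / 2 * (fact (2 * k) / (4 ^ k * fact k))"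
      by simp
    then show ?thesis using even[of "Suc k"] even[of k] n by simp
  qed
qed

lemma integrable_half_normal_poly: "integrable half_normal (\<lambda>x. poly p (of_real x :: complex))"
  unfolding poly_altdef
  by (intro Bochner_Integration.integrable_sum integrable_mult_right)
     (simp flip: of_real_power add: integrable_half_normal_power)

text \<open>Stein's identity, that is, integration by parts against the Gaussian density.\<close>

lemma stein_half_normal:
  "(\<integral>x. of_real x * poly p (of_real x) \<partial>half_normal)
     = (\<integral>x. poly (pderiv p) (of_real x :: complex) \<partial>half_normal) / 2"
proof -
  have monom: "(\<integral>x. poly (pCons 0 (monom c n)) (of_real x :: complex) \<partial>half_normal)
     = (\<integral>x. poly (pderiv (monom c n)) (of_real x) \<partial>half_normal) / 2" for c n
  proof -
    have "(\<integral>x. poly (pCons 0 (monom c n)) (of_real x :: complex) \<partial>half_normal)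
       = (\<integral>x. c * of_real (x ^ Suc n) \<partial>half_normal)"
      by (intro Bochner_Integration.integral_cong) (simp_all add: poly_monom)
    also have "\<dots> = c * of_real (real n / 2 * (\<integral>x. x ^ (n - 1) \<partial>half_normal))"
      by (simp only: integral_mult_right_zero integral_complex_of_real half_normal_moment)
    also have "\<dots> = (\<integral>x. of_nat n * c * of_real (x ^ (n - 1)) \<partial>half_normal) / 2"
      by (simp only: integral_mult_right_zero integral_complex_of_real) simp
    also have "\<dots> = (\<integral>x. poly (pderiv (monom c n)) (of_real x) \<partial>half_normal) / 2"
      by (simp add: pderiv_monom poly_monom)
    finally show ?thesis .
  qed
  let ?m = "\<lambda>i. monom (coeff p i) i"
  have p: "p = (\<Sum>i\<le>degree p. ?m i)" by (simp add: poly_as_sum_of_monoms)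
  have "(\<integral>x. of_real x * poly p (of_real x :: complex) \<partial>half_normal)
      = (\<integral>x. (\<Sum>i\<le>degree p. poly (pCons 0 (?m i)) (of_real x :: complex)) \<partial>half_normal)"
    by (subst p) (simp add: poly_sum sum_distrib_left)
  also have "\<dots> = (\<Sum>i\<le>degree p. \<integral>x. poly (pCons 0 (?m i)) (of_real x :: complex) \<partial>half_normal)"
    by (intro Bochner_Integration.integral_sum integrable_half_normal_poly)
  also have "\<dots> = (\<Sum>i\<le>degree p. \<integral>x. poly (pderiv (?m i)) (of_real x) \<partial>half_normal) / 2"
    by (simp only: monom sum_divide_distrib)
  also have "(\<Sum>i\<le>degree p. \<integral>x. poly (pderiv (?m i)) (of_real x) \<partial>half_normal)
      = (\<integral>x. (\<Sum>i\<le>degree p. poly (pderiv (?m i)) (of_real x :: complex)) \<partial>half_normal)"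
    by (intro Bochner_Integration.integral_sum[symmetric] integrable_half_normal_poly)
  also have "\<dots> = (\<integral>x. poly (pderiv p) (of_real x :: complex) \<partial>half_normal)"
    by (subst (3) p) (simp add: poly_sum pderiv_sum)
  finally show ?thesis .
qed

abbreviation half_normal_pair :: "(real \<times> real) measure" where
  "half_normal_pair \<equiv> half_normal \<Otimes>\<^sub>M half_normal"

abbreviation to_complex :: "real \<times> real \<Rightarrow> complex" where
  "to_complex z \<equiv> of_real (fst z) + \<i> * of_real (snd z)"

lemma to_complex_borel [measurable]: "to_complex \<in> borel_measurable half_normal_pair"
proof -
  have "to_complex \<in> borel \<rightarrow>\<^sub>M borel"
    by (intro borel_measurable_continuous_onI continuous_intros)
  also have "borel = (borel \<Otimes>\<^sub>M borel :: (real \<times> real) measure)" by (simp add: borel_prod)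
  finally show ?thesis by (simp cong: measurable_cong_sets)
qed

lemma integrable_half_normal_pair:
  fixes f :: "real \<times> real \<Rightarrow> complex"
  assumes [measurable]: "f \<in> borel_measurable half_normal_pair"
    and le: "\<And>z. cmod (f z) \<le> (\<bar>fst z\<bar> + \<bar>snd z\<bar>) ^ n"
  shows "integrable half_normal_pair f"
proof (rule Bochner_Integration.integrable_bound)
  have abs: "integrable half_normal (\<lambda>x. \<bar>x\<bar> ^ n)"
    using integrable_norm[OF integrable_half_normal_power[of n]] by (simp add: power_abs)
  show "integrable half_normal_pair (\<lambda>z. 2 ^ n * (\<bar>fst z\<bar> ^ n + \<bar>snd z\<bar> ^ n))"
  proof (rule half_normal.Fubini_integrable)
    show "AE x in half_normal. integrable half_normal (\<lambda>y. 2 ^ n * (\<bar>fst (x, y)\<bar> ^ n + \<bar>snd (x, y)\<bar> ^ n))"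
      using abs by (intro AE_I2 integrable_mult_right Bochner_Integration.integrable_add) auto
    have "(\<integral>y. norm (2 ^ n * (\<bar>fst (x, y)\<bar> ^ n + \<bar>snd (x, y)\<bar> ^ n)) \<partial>half_normal)
       = 2 ^ n * (\<bar>x\<bar> ^ n + (\<integral>y. \<bar>y\<bar> ^ n \<partial>half_normal))" for x
      using abs half_normal.M1.prob_space by (simp add: distrib_left)
    then show "integrable half_normal (\<lambda>x. \<integral>y. norm (2 ^ n * (\<bar>fst (x, y)\<bar> ^ n + \<bar>snd (x, y)\<bar> ^ n)) \<partial>half_normal)"
      using abs by simp
  qed measurable
  have "(\<bar>x\<bar> + \<bar>y\<bar>) ^ n \<le> 2 ^ n * (\<bar>x\<bar> ^ n + \<bar>y\<bar> ^ n)" for x y :: real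
  proof -
    have "(\<bar>x\<bar> + \<bar>y\<bar>) ^ n \<le> (2 * max \<bar>x\<bar> \<bar>y\<bar>) ^ n"
      by (intro power_mono) auto
    also have "\<dots> = 2 ^ n * max \<bar>x\<bar> \<bar>y\<bar> ^ n" by (simp add: power_mult_distrib)
    also have "\<dots> \<le> 2 ^ n * (\<bar>x\<bar> ^ n + \<bar>y\<bar> ^ n)"
      by (intro mult_left_mono) (auto simp: max_def)
    finally show ?thesis .
  qed
  then show "AE z in half_normal_pair. norm (f z) \<le> norm (2 ^ n * (\<bar>fst z\<bar> ^ n + \<bar>snd z\<bar> ^ n))"
    using le by (intro AE_I2) (simp, meson order_trans)
qed fact

definition gaussian_moment :: "nat \<Rightarrow> nat \<Rightarrow> complex" where
  "gaussian_moment a b = (\<integral>z. to_complex z ^ a * cnj (to_complex z) ^ b \<partial>half_normal_pair)"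

lemma norm_to_complex_le: "cmod (to_complex z) \<le> \<bar>fst z\<bar> + \<bar>snd z\<bar>"
  using norm_triangle_ineq[of "of_real (fst z)" "\<i> * of_real (snd z)"] by (simp add: norm_mult)

lemma to_complex_power_borel [measurable]:
  "(\<lambda>z. to_complex z ^ a * cnj (to_complex z) ^ b) \<in> borel_measurable half_normal_pair"
  by (intro borel_measurable_times borel_measurable_power borel_measurable_cnj to_complex_borel)

lemma integrable_to_complex:
  "integrable half_normal_pair (\<lambda>z. to_complex z ^ a * cnj (to_complex z) ^ b)"
proof (rule integrable_half_normal_pair[where n = "a + b"])
  fix z show "cmod (to_complex z ^ a * cnj (to_complex z) ^ b) \<le> (\<bar>fst z\<bar> + \<bar>snd z\<bar>) ^ (a + b)"
    unfolding norm_mult norm_power complex_mod_cnj power_add[symmetric]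
    by (rule power_mono[OF norm_to_complex_le norm_ge_zero])
qed measurable

lemma integrable_coordinate_to_complex:
  "integrable half_normal_pair (\<lambda>z. of_real (fst z) * (to_complex z ^ a * cnj (to_complex z) ^ b))"
  "integrable half_normal_pair (\<lambda>z. of_real (snd z) * (to_complex z ^ a * cnj (to_complex z) ^ b))"
proof -
  have *: "cmod (of_real c * (to_complex z ^ a * cnj (to_complex z) ^ b)) \<le> (\<bar>fst z\<bar> + \<bar>snd z\<bar>) ^ Suc (a + b)"
    if "\<bar>c\<bar> \<le> \<bar>fst z\<bar> + \<bar>snd z\<bar>" for c z
    unfolding norm_mult norm_power complex_mod_cnj power_add[symmetric] power_Suc norm_of_real
    by (intro mult_mono that power_mono norm_to_complex_le) auto
  show "integrable half_normal_pair (\<lambda>z. of_real (fst z) * (to_complex z ^ a * cnj (to_complex z) ^ b))"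
    by (rule integrable_half_normal_pair[OF _ *]) auto
  show "integrable half_normal_pair (\<lambda>z. of_real (snd z) * (to_complex z ^ a * cnj (to_complex z) ^ b))"
    by (rule integrable_half_normal_pair[OF _ *]) auto
qed

lemma poly_pderiv_power_mult:
  "poly (pderiv (p ^ a * q ^ b)) x =
     of_nat a * (poly p x ^ (a - 1) * poly q x ^ b) * poly (pderiv p) x
     + of_nat b * (poly p x ^ a * poly q x ^ (b - 1)) * poly (pderiv q) x"
  by (simp add: pderiv_mult pderiv_power poly_power algebra_simps)

text \<open>For a fixed imaginary part \<open>y\<close> the integrand is a polynomial in the real part, to which the
  one-dimensional identity applies; likewise with the two parts exchanged.\<close>

lemma gaussian_moment_fst:
  "(\<integral>z. of_real (fst z) * (to_complex z ^ a * cnj (to_complex z) ^ b) \<partial>half_normal_pair)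
     = (of_nat a * gaussian_moment (a - 1) b + of_nat b * gaussian_moment a (b - 1)) / 2"
proof -
  define P where "P = (\<lambda>y. [:\<i> * of_real y, 1:] ^ a * [:- \<i> * of_real y, 1:] ^ b :: complex poly)"
  have P: "poly (P y) (of_real x) = to_complex (x, y) ^ a * cnj (to_complex (x, y)) ^ b" for x y
    by (simp add: P_def poly_power add.commute)
  have dP: "poly (pderiv (P y)) (of_real x) =
      of_nat a * (to_complex (x, y) ^ (a - 1) * cnj (to_complex (x, y)) ^ b)
      + of_nat b * (to_complex (x, y) ^ a * cnj (to_complex (x, y)) ^ (b - 1))" for x y
    unfolding P_def poly_pderiv_power_mult by (simp add: pderiv_pCons algebra_simps)
  have "(\<integral>z. of_real (fst z) * (to_complex z ^ a * cnj (to_complex z) ^ b) \<partial>half_normal_pair)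
     = (\<integral>y. (\<integral>x. of_real x * (to_complex (x, y) ^ a * cnj (to_complex (x, y)) ^ b) \<partial>half_normal) \<partial>half_normal)"
    using half_normal.integral_snd[of "\<lambda>x y. of_real x * (to_complex (x, y) ^ a * cnj (to_complex (x, y)) ^ b)"]
      integrable_coordinate_to_complex(1)[of a b] by (simp add: case_prod_beta')
  also have "\<dots> = (\<integral>y. (\<integral>x. poly (pderiv (P y)) (of_real x) \<partial>half_normal) / 2 \<partial>half_normal)"
    unfolding P[symmetric] stein_half_normal ..
  also have "\<dots> = (\<integral>y. (\<integral>x. poly (pderiv (P y)) (of_real x) \<partial>half_normal) \<partial>half_normal) / 2"
    by simp
  also have "(\<integral>y. (\<integral>x. poly (pderiv (P y)) (of_real x) \<partial>half_normal) \<partial>half_normal)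
     = (\<integral>z. of_nat a * (to_complex z ^ (a - 1) * cnj (to_complex z) ^ b)
      + of_nat b * (to_complex z ^ a * cnj (to_complex z) ^ (b - 1)) \<partial>half_normal_pair)"
    unfolding dP
    using half_normal.integral_snd[of "\<lambda>x y. of_nat a * (to_complex (x, y) ^ (a - 1) * cnj (to_complex (x, y)) ^ b)
      + of_nat b * (to_complex (x, y) ^ a * cnj (to_complex (x, y)) ^ (b - 1))"]
      integrable_to_complex[of "a - 1" b] integrable_to_complex[of a "b - 1"]
    by (simp add: case_prod_beta')
  also have "\<dots> = of_nat a * gaussian_moment (a - 1) b + of_nat b * gaussian_moment a (b - 1)"
    unfolding gaussian_moment_def
    using integrable_to_complex[of "a - 1" b] integrable_to_complex[of a "b - 1"] by simp
  finally show ?thesis .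
qed

lemma gaussian_moment_snd:
  "(\<integral>z. of_real (snd z) * (to_complex z ^ a * cnj (to_complex z) ^ b) \<partial>half_normal_pair)
     = \<i> * (of_nat a * gaussian_moment (a - 1) b - of_nat b * gaussian_moment a (b - 1)) / 2"
proof -
  define P where "P = (\<lambda>x. [:of_real x, \<i>:] ^ a * [:of_real x, - \<i>:] ^ b :: complex poly)"
  have P: "poly (P x) (of_real y) = to_complex (x, y) ^ a * cnj (to_complex (x, y)) ^ b" for x y
    by (simp add: P_def poly_power mult.commute)
  have dP: "poly (pderiv (P x)) (of_real y) =
      \<i> * of_nat a * (to_complex (x, y) ^ (a - 1) * cnj (to_complex (x, y)) ^ b)
      - \<i> * of_nat b * (to_complex (x, y) ^ a * cnj (to_complex (x, y)) ^ (b - 1))" for x y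
    unfolding P_def poly_pderiv_power_mult by (simp add: pderiv_pCons algebra_simps)
  have "(\<integral>z. of_real (snd z) * (to_complex z ^ a * cnj (to_complex z) ^ b) \<partial>half_normal_pair)
     = (\<integral>x. (\<integral>y. of_real y * (to_complex (x, y) ^ a * cnj (to_complex (x, y)) ^ b) \<partial>half_normal) \<partial>half_normal)"
    using half_normal.integral_fst'[OF integrable_coordinate_to_complex(2)[of a b]] by simp
  also have "\<dots> = (\<integral>x. (\<integral>y. poly (pderiv (P x)) (of_real y) \<partial>half_normal) / 2 \<partial>half_normal)"
    unfolding P[symmetric] stein_half_normal ..
  also have "\<dots> = (\<integral>x. (\<integral>y. poly (pderiv (P x)) (of_real y) \<partial>half_normal) \<partial>half_normal) / 2"
    by simp
  also have "(\<integral>x. (\<integral>y. poly (pderiv (P x)) (of_real y) \<partial>half_normal) \<partial>half_normal)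
     = (\<integral>z. \<i> * of_nat a * (to_complex z ^ (a - 1) * cnj (to_complex z) ^ b)
      - \<i> * of_nat b * (to_complex z ^ a * cnj (to_complex z) ^ (b - 1)) \<partial>half_normal_pair)"
    unfolding dP
    using half_normal.integral_fst'[of "\<lambda>z. \<i> * of_nat a * (to_complex z ^ (a - 1) * cnj (to_complex z) ^ b)
      - \<i> * of_nat b * (to_complex z ^ a * cnj (to_complex z) ^ (b - 1))"]
      integrable_to_complex[of "a - 1" b] integrable_to_complex[of a "b - 1"]
    by simp
  also have "\<dots> = \<i> * of_nat a * gaussian_moment (a - 1) b - \<i> * of_nat b * gaussian_moment a (b - 1)"
    unfolding gaussian_moment_def
    using integrable_to_complex[of "a - 1" b] integrable_to_complex[of a "b - 1"] by simp
  finally show ?thesis by (simp add: algebra_simps)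
qed

text \<open>The complex form of Stein's identity: the expectation of \<open>z f\<close> is that of the derivative of \<open>f\<close>
  with respect to the conjugate of \<open>z\<close>.\<close>

lemma gaussian_moment_Suc: "gaussian_moment (Suc a) b = of_nat b * gaussian_moment a (b - 1)"
proof -
  have "gaussian_moment (Suc a) b =
     (\<integral>z. of_real (fst z) * (to_complex z ^ a * cnj (to_complex z) ^ b)
        + \<i> * (of_real (snd z) * (to_complex z ^ a * cnj (to_complex z) ^ b)) \<partial>half_normal_pair)"
    unfolding gaussian_moment_def by (intro Bochner_Integration.integral_cong) (simp_all add: algebra_simps)
  also have "\<dots> = (of_nat a * gaussian_moment (a - 1) b + of_nat b * gaussian_moment a (b - 1)) / 2
      + \<i> * (\<i> * (of_nat a * gaussian_moment (a - 1) b - of_nat b * gaussian_moment a (b - 1)) / 2)"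
    using integrable_coordinate_to_complex[of a b]
    by (simp only: Bochner_Integration.integral_add integrable_mult_right integral_mult_right_zero
        gaussian_moment_fst gaussian_moment_snd)
  also have "(A + B) / 2 + \<i> * (\<i> * (A - B) / 2) = B" for A B :: complex
    by (simp add: diff_divide_distrib add_divide_distrib)
  finally show ?thesis .
qed

lemma gaussian_moment_eq: "gaussian_moment a b = (if a = b then fact a else 0)"
proof (induction a arbitrary: b)
  case 0
  show ?case
  proof (cases b)
    case 0
    then show ?thesis by (simp add: gaussian_moment_def half_normal.P.prob_space)
  next
    case (Suc c)
    have "gaussian_moment 0 b = (\<integral>z. cnj (to_complex z ^ b) \<partial>half_normal_pair)"
      by (simp add: gaussian_moment_def del: integral_cnj)
    also have "\<dots> = cnj (gaussian_moment b 0)"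
      using integrable_to_complex[of b 0] unfolding gaussian_moment_def
      by (simp only: Bochner_Integration.integral_cnj power_0 mult_1_right)
    finally have "gaussian_moment 0 b = cnj (gaussian_moment b 0)" .
    then show ?thesis using Suc by (simp add: gaussian_moment_Suc)
  qed
next
  case (Suc a)
  then show ?case by (cases b) (auto simp: gaussian_moment_Suc)
qed

lemma lborel_complex_eq: "(lborel :: complex measure) = distr (lborel \<Otimes>\<^sub>M lborel) borel to_complex"
proof (rule lborel_eqI)
  have [measurable]: "to_complex \<in> borel_measurable (lborel \<Otimes>\<^sub>M lborel)"
    using to_complex_borel by (simp cong: measurable_cong_sets)
  fix l u :: complex assume le: "\<And>b. b \<in> Basis \<Longrightarrow> l \<bullet> b \<le> u \<bullet> b"
  have le': "Re l \<le> Re u" "Im l \<le> Im u"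
    using le[of 1] le[of \<i>] by (auto simp: Basis_complex_def)
  have "to_complex -` box l u \<inter> space (lborel \<Otimes>\<^sub>M lborel) = box (Re l) (Re u) \<times> box (Im l) (Im u)"
    by (auto simp: box_def Basis_complex_def space_pair_measure)
  then have "emeasure (distr (lborel \<Otimes>\<^sub>M lborel) borel to_complex) (box l u)
      = emeasure (lborel \<Otimes>\<^sub>M lborel) (box (Re l) (Re u) \<times> box (Im l) (Im u))"
    by (subst emeasure_distr) auto
  also have "\<dots> = emeasure lborel (box (Re l) (Re u)) * emeasure lborel (box (Im l) (Im u))"
    by (rule lborel.emeasure_pair_measure_Times) auto
  also have "\<dots> = ennreal (\<Prod>b\<in>Basis. (u - l) \<bullet> b)"
    using le' by (simp add: Basis_complex_def ennreal_mult emeasure_lborel_box_eq)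
  finally show "emeasure (distr (lborel \<Otimes>\<^sub>M lborel) borel to_complex) (box l u)
     = ennreal (\<Prod>b\<in>Basis. (u - l) \<bullet> b)" .
qed simp

text \<open>The Gaussian density factors: \<open>exp (- \<bar>z\<bar>\<^sup>2) / pi\<close> is the product of two densities \<open>exp (- t\<^sup>2)\<close>
  over \<open>sqrt pi\<close>, at the real and at the imaginary part of \<open>z\<close>.\<close>

lemma standard_complex_gaussian_distr:
  assumes "standard_complex_gaussian M Z"
  shows "distr M borel Z = distr half_normal_pair borel to_complex"
proof -
  have m: "to_complex \<in> borel_measurable (lborel \<Otimes>\<^sub>M lborel)"
    using to_complex_borel by (simp cong: measurable_cong_sets)
  have "distr M borel Z = distr M lborel Z" by (rule distr_cong) auto
  also have "\<dots> = density lborel (\<lambda>z. ennreal (exp (- (cmod z)\<^sup>2) / pi))"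
    using assms unfolding standard_complex_gaussian_def by (rule distributed_distr_eq_density)
  also have "\<dots> = density (distr (lborel \<Otimes>\<^sub>M lborel) borel to_complex) (\<lambda>z. ennreal (exp (- (cmod z)\<^sup>2) / pi))"
    by (simp only: lborel_complex_eq)
  also have "\<dots> = distr (density (lborel \<Otimes>\<^sub>M lborel) (\<lambda>z. ennreal (exp (- (cmod (to_complex z))\<^sup>2) / pi))) borel to_complex"
    by (rule density_distr) (use m in measurable)
  also have "(\<lambda>z. ennreal (exp (- (cmod (to_complex z))\<^sup>2) / pi)) =
      (\<lambda>(x, y). ennreal (half_normal_density x) * ennreal (half_normal_density y))"
  proof (rule ext, clarify)
    fix x y :: real
    have "(cmod (to_complex (x, y)))\<^sup>2 = x\<^sup>2 + y\<^sup>2" by (simp add: cmod_power2)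
    then have "exp (- (cmod (to_complex (x, y)))\<^sup>2) / pi = half_normal_density x * half_normal_density y"
      by (simp add: half_normal_density_eq exp_add[symmetric])
    then show "ennreal (exp (- (cmod (to_complex (x, y)))\<^sup>2) / pi)
        = ennreal (half_normal_density x) * ennreal (half_normal_density y)"
      by (simp add: ennreal_mult normal_density_nonneg)
  qed
  also have "density (lborel \<Otimes>\<^sub>M lborel) (\<lambda>(x, y). ennreal (half_normal_density x) * ennreal (half_normal_density y))
      = half_normal_pair"
    by (rule pair_measure_density[symmetric])
       (auto intro: prob_space_imp_sigma_finite prob_space_half_normal lborel.sigma_finite_measure_axioms)
  finally show ?thesis .
qed

lemma standard_complex_gaussian_moment:
  assumes "standard_complex_gaussian M Z"
  shows "integrable M (\<lambda>x. Z x ^ a * cnj (Z x) ^ b)"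
    and "(\<integral>x. Z x ^ a * cnj (Z x) ^ b \<partial>M) = (if a = b then fact a else 0)"
proof -
  have Z: "Z \<in> borel_measurable M"
    using assms unfolding standard_complex_gaussian_def by (auto dest: distributed_measurable)
  have f: "(\<lambda>z. z ^ a * cnj z ^ b) \<in> borel_measurable (borel :: complex measure)"
    by (intro borel_measurable_continuous_onI continuous_intros)
  note d = standard_complex_gaussian_distr[OF assms]
  have "integrable (distr half_normal_pair borel to_complex) (\<lambda>z. z ^ a * cnj z ^ b)"
    by (rule integrable_distr) (use f integrable_to_complex in \<open>auto simp: integrable_distr_eq\<close>)
  then show "integrable M (\<lambda>x. Z x ^ a * cnj (Z x) ^ b)"
    unfolding d[symmetric] integrable_distr_eq[OF Z f] .
  show "(\<integral>x. Z x ^ a * cnj (Z x) ^ b \<partial>M) = (if a = b then fact a else 0)"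
    using integral_distr[OF Z f] integral_distr[OF to_complex_borel f]
    unfolding d gaussian_moment_eq[symmetric] gaussian_moment_def by simp
qed

section \<open>Asymptotic moments of traces\<close>

text \<open>A word with positive seam whose trace is that of \<open>w\<close> or, for \<open>s = False\<close>, its conjugate.\<close>

definition cyclic_representative :: "word \<Rightarrow> bool \<Rightarrow> word" where
  "cyclic_representative w s =
     (let v = seam_rotation (cyclic_reduction w) in if s then v else inv_word v)"

lemma cyclic_representative:
  assumes "reduced w" "w \<noteq> []"
  shows "cyclically_reduced (cyclic_representative w s)" "cyclic_representative w s \<noteq> []"
    "positive_seam (cyclic_representative w s)"
  using cyclically_reduced_cyclic_reduction[OF assms] positive_seam_seam_rotation[of "cyclic_reduction w"]
  by (auto simp: cyclic_representative_def Let_def seam_rotation_rotate positive_seam_inv_word)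

lemma rotation_equiv_cyclic_representative:
  assumes "reduced w"
  shows "rotation_equiv (cyclic_reduction (if s then w else inv_word w)) (cyclic_representative w s)"
proof -
  have "rotation_equiv (cyclic_reduction w) (seam_rotation (cyclic_reduction w))"
    unfolding seam_rotation_rotate by (rule rotation_equiv_rotate)
  then show ?thesis
    using rotation_equiv_inv_word
    by (cases s) (simp_all add: cyclic_representative_def cyclic_reduction_inv_word[OF assms])
qed

lemma inv_word_cyclic_representative:
  "inv_word (cyclic_representative w s) = cyclic_representative w (\<not> s)"
  by (simp add: cyclic_representative_def Let_def)

lemma pair_trace_cyclic_representative:
  assumes "x \<in> unitary_pairs N" "reduced w"
  shows "pair_trace N (cyclic_representative w s) x = (if s then pair_trace N w x else cnj (pair_trace N w x))"
  using assms
  by (simp add: cyclic_representative_def Let_def seam_rotation_rotate pair_trace_inv_word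
      pair_trace_rotate pair_trace_cyclic_reduction del: rotate_Suc)

lemma matchings_same_word:
  assumes "reduced w" "w \<noteq> []"
  shows "matchings (cyclic_representative w s) (cyclic_representative w t)
     = (if t = (\<not> s) then rotation_count w else 0)"
proof (cases "t = (\<not> s)")
  case True
  let ?v = "seam_rotation (cyclic_reduction w)"
  have "matchings (cyclic_representative w s) (cyclic_representative w (\<not> s)) = card {k. k < length ?v \<and> rotate k ?v = ?v}"
    using matchings_self_inverse[of ?v]
    by (cases s) (simp_all add: cyclic_representative_def matchings_def)
  then show ?thesis
    using True by (simp only: seam_rotation_rotate rotation_stabilizer_rotate rotation_count_def if_True simp_thms)
next
  case False
  then have "t = s" by auto
  then show ?thesis
    using rotate_neq_inv_word[of "cyclic_representative w s"] cyclic_representative[OF assms, of s] False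
    by (auto simp: matchings_def cyclically_reduced_def)
qed

text \<open>A matching would make one of the words conjugate to the other or to its inverse.\<close>

lemma matchings_different_words:
  assumes "reduced v" "reduced w"
    and "\<not> cyclically_equivalent v w" "\<not> cyclically_equivalent v (inv_word w)"
  shows "matchings (cyclic_representative v s) (cyclic_representative w t) = 0"
proof (rule matchings_eq_0)
  let ?r = "\<lambda>w s. cyclic_reduction (if s then w else inv_word w)"
  have inv: "inv_word (?r w s) = ?r w (\<not> s)" if "reduced w" for w s
    using that by (simp add: cyclic_reduction_inv_word)
  show "\<not> rotation_equiv (cyclic_representative w t) (inv_word (cyclic_representative v s))"
  proof
    assume "rotation_equiv (cyclic_representative w t) (inv_word (cyclic_representative v s))"
    then have "rotation_equiv (cyclic_representative w t) (cyclic_representative v (\<not> s))"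
      by (simp only: inv_word_cyclic_representative)
    then have *: "rotation_equiv (?r v (\<not> s)) (?r w t)"
      using rotation_equiv_cyclic_representative[OF assms(1), of "\<not> s"]
        rotation_equiv_cyclic_representative[OF assms(2), of t]
      by (meson rotation_equiv_sym rotation_equiv_trans)
    have "rotation_equiv (?r v True) (?r w (t = (\<not> s)))"
    proof (cases s)
      case False
      then show ?thesis using * by simp
    next
      case True
      then show ?thesis
        using rotation_equiv_inv_word[OF *] inv[OF assms(1), of "\<not> s"] inv[OF assms(2), of t] by simp
    qed
    then show False
      using assms(3,4) by (cases "t = (\<not> s)") (simp_all add: cyclically_equivalent_iff)
  qed
qed

text \<open>The index \<open>(i, True)\<close> stands for the trace of the \<open>i\<close>-th word, \<open>(i, False)\<close> for its conjugate.\<close>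

definition exponent_mset :: "nat \<Rightarrow> (nat \<Rightarrow> nat) \<Rightarrow> (nat \<Rightarrow> nat) \<Rightarrow> (nat \<times> bool) multiset" where
  "exponent_mset p \<alpha> \<beta> = (\<Sum>i<p. replicate_mset (\<alpha> i) (i, True) + replicate_mset (\<beta> i) (i, False))"

lemma count_exponent_mset:
  assumes "i < p"
  shows "count (exponent_mset p \<alpha> \<beta>) (i, True) = \<alpha> i" "count (exponent_mset p \<alpha> \<beta>) (i, False) = \<beta> i"
  using assms by (simp_all add: exponent_mset_def count_sum)

lemma set_exponent_mset: "set_mset (exponent_mset p \<alpha> \<beta>) \<subseteq> {..<p} \<times> UNIV"
  unfolding exponent_mset_def by (induction p) (auto split: if_splits)

lemma prod_mset_exponent_mset:
  "(\<Prod>z\<in>#exponent_mset p \<alpha> \<beta>. f z) = (\<Prod>i<p. f (i, True) ^ \<alpha> i * f (i, False) ^ \<beta> i :: complex)"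
  unfolding exponent_mset_def by (induction p) (simp_all add: mult.assoc)

lemma trace_moment_conv_moment:
  assumes haar: "is_haar_unitary N (\<mu> N)" and words: "\<And>i. i < p \<Longrightarrow> reduced (w i)"
  shows "trace_moment \<mu> p w \<alpha> \<beta> N =
     haar_unitary.moment N (\<mu> N)
       (image_mset (\<lambda>(i, s). cyclic_representative (w i) s) (exponent_mset p \<alpha> \<beta>))"
proof -
  interpret haar_unitary N "\<mu> N" by unfold_locales fact
  have "trace_product (image_mset (\<lambda>(i, s). cyclic_representative (w i) s) (exponent_mset p \<alpha> \<beta>)) x
      = (\<Prod>i<p. pair_trace N (w i) x ^ \<alpha> i * cnj (pair_trace N (w i) x) ^ \<beta> i)"
    if x: "x \<in> unitary_pairs N" for x
  proof -
    have "trace_product (image_mset (\<lambda>(i, s). cyclic_representative (w i) s) (exponent_mset p \<alpha> \<beta>)) x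
       = (\<Prod>z\<in>#exponent_mset p \<alpha> \<beta>. pair_trace N (cyclic_representative (w (fst z)) (snd z)) x)"
      by (simp add: image_mset.compositionality comp_def case_prod_beta')
    also have "\<dots> = (\<Prod>i<p. pair_trace N (w i) x ^ \<alpha> i * cnj (pair_trace N (w i) x) ^ \<beta> i)"
      unfolding prod_mset_exponent_mset
      by (intro prod.cong refl) (simp add: pair_trace_cyclic_representative[OF x] words)
    finally show ?thesis .
  qed
  then show ?thesis
    unfolding moment_def trace_moment_def
    by (intro Bochner_Integration.integral_cong) (auto simp: space_haar_pair)
qed

lemma abs_trace_moment_eq:
  "of_real (abs_trace_moment \<mu> p w \<alpha> N) = trace_moment \<mu> p w \<alpha> \<alpha> N"
proof -
  have "z ^ n * cnj z ^ n = of_real (cmod z ^ (2 * n))" for z n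
    unfolding power_mult_distrib[symmetric] complex_norm_square[symmetric] by (simp add: power_mult)
  then show ?thesis
    unfolding abs_trace_moment_def trace_moment_def
    by (simp del: of_real_prod of_real_power flip: of_real_prod integral_complex_of_real)
qed

lemma tendsto_of_bigo_inverse:
  assumes "(\<lambda>N. f N - c) \<in> O(\<lambda>N. 1 / of_nat N :: complex)"
  shows "f \<longlonglongrightarrow> c"
proof -
  have "(\<lambda>N. 1 / of_nat N :: complex) \<in> o(\<lambda>_. 1)"
    using lim_1_over_n by (intro smalloI_tendsto) auto
  with assms have "(\<lambda>N. f N - c) \<in> o(\<lambda>_. 1)"
    by (rule landau_o.big_small_trans)
  then have "(\<lambda>N. f N - c) \<longlonglongrightarrow> 0"
    by (auto dest: smalloD_tendsto)
  then show ?thesis by (rule LIM_zero_cancel)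
qed

lemma const_in_bigo_inverse_imp_0:
  assumes "(\<lambda>_. c) \<in> O(\<lambda>N. 1 / of_nat N :: complex)"
  shows "c = 0"
  using tendsto_of_bigo_inverse[of "\<lambda>_. c" 0] assms by (simp add: tendsto_const_iff)

lemma independent_gaussian_moment:
  fixes Z :: "nat \<Rightarrow> 'm \<Rightarrow> complex" and c :: "nat \<Rightarrow> real"
  assumes M: "prob_space M" and indep: "prob_space.indep_vars M (\<lambda>_. borel) Z {..<p}"
    and Z: "\<And>i. i < p \<Longrightarrow> standard_complex_gaussian M (Z i)" and c: "\<And>i. c i \<ge> 0"
  shows "integrable M (\<lambda>x. \<Prod>i<p. (of_real (sqrt (c i)) * Z i x) ^ \<alpha> i * cnj (of_real (sqrt (c i)) * Z i x) ^ \<beta> i)"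
    (is "integrable M ?G")
    and "(\<integral>x. (\<Prod>i<p. (of_real (sqrt (c i)) * Z i x) ^ \<alpha> i * cnj (of_real (sqrt (c i)) * Z i x) ^ \<beta> i) \<partial>M)
      = (if \<forall>i<p. \<beta> i = \<alpha> i then \<Prod>i<p. fact (\<alpha> i) * of_real (c i) ^ \<alpha> i else 0)"
proof -
  interpret prob_space M by fact
  define X where "X = (\<lambda>i x. (of_real (sqrt (c i)) * Z i x) ^ \<alpha> i * cnj (of_real (sqrt (c i)) * Z i x) ^ \<beta> i)"
  have X: "X = (\<lambda>i x. of_real (sqrt (c i) ^ (\<alpha> i + \<beta> i)) * (Z i x ^ \<alpha> i * cnj (Z i x) ^ \<beta> i))"
    by (auto simp: X_def fun_eq_iff power_mult_distrib power_add)
  have int: "integrable M (X i)" if "i < p" for i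
    unfolding X by (intro integrable_mult_right standard_complex_gaussian_moment Z that)
  have "indep_vars (\<lambda>_. borel) (\<lambda>i x. (\<lambda>z. (of_real (sqrt (c i)) * z) ^ \<alpha> i * cnj (of_real (sqrt (c i)) * z) ^ \<beta> i) (Z i x)) {..<p}"
    by (rule indep_vars_compose2[OF indep]) (intro borel_measurable_continuous_onI continuous_intros)
  then have ind: "indep_vars (\<lambda>_. borel) X {..<p}" by (simp add: X_def)
  have "integrable M (\<lambda>x. \<Prod>i<p. X i x)"
    by (rule indep_vars_integrable) (use ind int in auto)
  then show "integrable M ?G" by (simp only: X_def)
  have "(\<integral>x. (\<Prod>i<p. X i x) \<partial>M) = (\<Prod>i<p. \<integral>x. X i x \<partial>M)"
    by (rule indep_vars_lebesgue_integral) (use ind int in auto)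
  also have "\<dots> = (\<Prod>i<p. if \<beta> i = \<alpha> i then fact (\<alpha> i) * of_real (c i) ^ \<alpha> i else 0)"
  proof (intro prod.cong refl)
    fix i assume "i \<in> {..<p}"
    then have "(\<integral>x. X i x \<partial>M) = of_real (sqrt (c i) ^ (\<alpha> i + \<beta> i)) * (if \<alpha> i = \<beta> i then fact (\<alpha> i) else 0)"
      unfolding X by (simp only: integral_mult_right_zero standard_complex_gaussian_moment(2)[OF Z] lessThan_iff)
    moreover have "sqrt (c i) ^ (\<alpha> i + \<alpha> i) = c i ^ \<alpha> i"
      using c[of i] by (simp add: power_mult_distrib[symmetric] power_add)
    ultimately show "(\<integral>x. X i x \<partial>M) = (if \<beta> i = \<alpha> i then fact (\<alpha> i) * of_real (c i) ^ \<alpha> i else 0)"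
      by (auto simp flip: of_real_power)
  qed
  also have "\<dots> = (if \<forall>i<p. \<beta> i = \<alpha> i then \<Prod>i<p. fact (\<alpha> i) * of_real (c i) ^ \<alpha> i else 0)"
  proof (cases "\<forall>i<p. \<beta> i = \<alpha> i")
    case False
    then have "(\<Prod>i<p. if \<beta> i = \<alpha> i then fact (\<alpha> i) * complex_of_real (c i) ^ \<alpha> i else 0) = 0"
      by (intro prod_zero) auto
    with False show ?thesis by (simp only: if_False)
  qed auto
  finally show "(\<integral>x. ?G x \<partial>M) = (if \<forall>i<p. \<beta> i = \<alpha> i then \<Prod>i<p. fact (\<alpha> i) * of_real (c i) ^ \<alpha> i else 0)"
    by (simp only: X_def)
qed

lemma trace_moment_asymptotics:
  fixes w :: "nat \<Rightarrow> word"
  assumes haar: "\<And>N. is_haar_unitary N (\<mu> N)"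
    and words: "\<And>i. i < p \<Longrightarrow> reduced (w i) \<and> w i \<noteq> []"
    and distinct: "\<And>i k. i < p \<Longrightarrow> k < p \<Longrightarrow> i \<noteq> k \<Longrightarrow>
          \<not> cyclically_equivalent (w i) (w k) \<and> \<not> cyclically_equivalent (w i) (inv_word (w k))"
  shows "(\<lambda>N. trace_moment \<mu> p w \<alpha> \<beta> N
     - (if \<forall>i<p. \<beta> i = \<alpha> i then \<Prod>i<p. fact (\<alpha> i) * of_nat (rotation_count (w i)) ^ \<alpha> i else 0))
     \<in> O(\<lambda>N. 1 / of_nat N)"
proof -
  let ?u = "\<lambda>(i, s). cyclic_representative (w i) s" and ?E = "exponent_mset p \<alpha> \<beta>"
  have "(\<lambda>N. haar_unitary.moment N (\<mu> N) (image_mset ?u ?E)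
     - (if \<forall>i<p. count ?E (i, False) = count ?E (i, True)
        then \<Prod>i<p. fact (count ?E (i, True)) * of_nat (rotation_count (w i)) ^ count ?E (i, True) else 0))
     \<in> O(\<lambda>N. 1 / of_nat N)"
  proof (rule moment_pairings[OF haar])
    fix i k s t assume ik: "i < p" "k < p"
    show "matchings (?u (i, s)) (?u (k, t)) = (if k = i \<and> t = (\<not> s) then rotation_count (w i) else 0)"
      using words[OF ik(1)] words[OF ik(2)] distinct[OF ik]
      by (cases "k = i") (auto simp: matchings_same_word matchings_different_words)
  qed (use words cyclic_representative set_exponent_mset in auto)
  moreover have "(\<forall>i<p. count ?E (i, False) = count ?E (i, True)) \<longleftrightarrow> (\<forall>i<p. \<beta> i = \<alpha> i)"
    by (simp add: count_exponent_mset)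
  moreover have "(\<Prod>i<p. fact (count ?E (i, True)) * of_nat (rotation_count (w i)) ^ count ?E (i, True))
     = (\<Prod>i<p. fact (\<alpha> i) * of_nat (rotation_count (w i)) ^ \<alpha> i :: complex)"
    by (intro prod.cong) (simp_all add: count_exponent_mset)
  moreover have "trace_moment \<mu> p w \<alpha> \<beta> N = haar_unitary.moment N (\<mu> N) (image_mset ?u ?E)" for N
    by (intro trace_moment_conv_moment haar) (use words in auto)
  ultimately show ?thesis by (simp only:)
qed

theorem theorem4p1:
  fixes \<mu> :: "nat \<Rightarrow> complex mat measure"
    and p :: nat
    and w :: "nat \<Rightarrow> word"
    and M :: "'m measure"
    and Z :: "nat \<Rightarrow> 'm \<Rightarrow> complex"
  assumes haar: "\<And>N. is_haar_unitary N (\<mu> N)"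
    and words: "\<And>i. i < p \<Longrightarrow> reduced (w i) \<and> w i \<noteq> []"
    and distinct: "\<And>i k. i < p \<Longrightarrow> k < p \<Longrightarrow> i \<noteq> k \<Longrightarrow>
          \<not> cyclically_equivalent (w i) (w k) \<and> \<not> cyclically_equivalent (w i) (inv_word (w k))"
  shows
    "(\<forall>\<alpha> \<beta> :: nat \<Rightarrow> nat.
        (trace_moment \<mu> p w \<alpha> \<beta> \<notin> O(\<lambda>N. 1 / of_nat N)
           \<longleftrightarrow> (\<forall>N\<ge>1. trace_moment \<mu> p w \<alpha> \<beta> N = of_real (abs_trace_moment \<mu> p w \<alpha> N)))
      \<and> (trace_moment \<mu> p w \<alpha> \<beta> \<notin> O(\<lambda>N. 1 / of_nat N) \<longleftrightarrow> (\<forall>i<p. \<beta> i = \<alpha> i))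
      \<and> ((\<forall>i<p. \<beta> i = \<alpha> i) \<longrightarrow>
           (\<lambda>N. trace_moment \<mu> p w \<alpha> \<beta> N
                - (\<Prod>i<p. fact (\<alpha> i) * of_nat (rotation_count (w i)) ^ \<alpha> i))
             \<in> O(\<lambda>N. 1 / of_nat N)))
   \<and> (prob_space M
        \<and> prob_space.indep_vars M (\<lambda>_. borel) Z {..<p}
        \<and> (\<forall>i<p. standard_complex_gaussian M (Z i)) \<longrightarrow>
      (\<forall>\<alpha> \<beta> :: nat \<Rightarrow> nat.
        let G = (\<lambda>x. \<Prod>i<p. (of_real (sqrt (rotation_count (w i))) * Z i x) ^ \<alpha> i
                       * cnj (of_real (sqrt (rotation_count (w i))) * Z i x) ^ \<beta> i)
        in integrable M G \<and> trace_moment \<mu> p w \<alpha> \<beta> \<longlonglongrightarrow> (\<integral>x. G x \<partial>M)))"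
proof (intro conjI allI impI)
  let ?L = "\<lambda>\<alpha>. \<Prod>i<p. fact (\<alpha> i) * of_nat (rotation_count (w i)) ^ \<alpha> i :: complex"
  have asym: "(\<lambda>N. trace_moment \<mu> p w \<alpha> \<beta> N - (if \<forall>i<p. \<beta> i = \<alpha> i then ?L \<alpha> else 0)) \<in> O(\<lambda>N. 1 / of_nat N)"
    for \<alpha> \<beta> by (intro trace_moment_asymptotics haar words distinct)
  have L: "?L \<alpha> \<noteq> 0" for \<alpha>
    using words rotation_count_pos by auto
  fix \<alpha> \<beta> :: "nat \<Rightarrow> nat"
  show balanced: "trace_moment \<mu> p w \<alpha> \<beta> \<notin> O(\<lambda>N. 1 / of_nat N) \<longleftrightarrow> (\<forall>i<p. \<beta> i = \<alpha> i)" for \<alpha> \<beta>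
  proof (cases "\<forall>i<p. \<beta> i = \<alpha> i")
    case True
    have "trace_moment \<mu> p w \<alpha> \<beta> \<notin> O(\<lambda>N. 1 / of_nat N)"
    proof
      assume "trace_moment \<mu> p w \<alpha> \<beta> \<in> O(\<lambda>N. 1 / of_nat N)"
      moreover have "(\<lambda>N. trace_moment \<mu> p w \<alpha> \<beta> N - ?L \<alpha>) \<in> O(\<lambda>N. 1 / of_nat N)"
        using asym[of \<alpha> \<beta>] unfolding if_P[OF True] .
      ultimately have "(\<lambda>N. trace_moment \<mu> p w \<alpha> \<beta> N - (trace_moment \<mu> p w \<alpha> \<beta> N - ?L \<alpha>)) \<in> O(\<lambda>N. 1 / of_nat N)"
        by (rule sum_in_bigo(2))
      then have "(\<lambda>N::nat. ?L \<alpha>) \<in> O(\<lambda>N. 1 / of_nat N)" by simp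
      with L show False by (blast dest: const_in_bigo_inverse_imp_0)
    qed
    with True show ?thesis by blast
  next
    case False
    then have "trace_moment \<mu> p w \<alpha> \<beta> \<in> O(\<lambda>N. 1 / of_nat N)"
      using asym[of \<alpha> \<beta>] by (simp only: if_False diff_zero)
    with False show ?thesis by blast
  qed
  show "trace_moment \<mu> p w \<alpha> \<beta> \<notin> O(\<lambda>N. 1 / of_nat N)
       \<longleftrightarrow> (\<forall>N\<ge>1. trace_moment \<mu> p w \<alpha> \<beta> N = of_real (abs_trace_moment \<mu> p w \<alpha> N))"
  proof
    assume "trace_moment \<mu> p w \<alpha> \<beta> \<notin> O(\<lambda>N. 1 / of_nat N)"
    then have "\<forall>i<p. \<beta> i = \<alpha> i" by (simp only: balanced)
    then have "trace_moment \<mu> p w \<alpha> \<beta> N = trace_moment \<mu> p w \<alpha> \<alpha> N" for N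
      by (simp add: trace_moment_def)
    then show "\<forall>N\<ge>1. trace_moment \<mu> p w \<alpha> \<beta> N = of_real (abs_trace_moment \<mu> p w \<alpha> N)"
      by (simp add: abs_trace_moment_eq)
  next
    assume eq: "\<forall>N\<ge>1. trace_moment \<mu> p w \<alpha> \<beta> N = of_real (abs_trace_moment \<mu> p w \<alpha> N)"
    have "eventually (\<lambda>N. trace_moment \<mu> p w \<alpha> \<beta> N = trace_moment \<mu> p w \<alpha> \<alpha> N) at_top"
      using eventually_ge_at_top[of 1] by eventually_elim (use eq in \<open>simp add: abs_trace_moment_eq\<close>)
    then have "trace_moment \<mu> p w \<alpha> \<beta> \<in> O(\<lambda>N. 1 / of_nat N) \<longleftrightarrow> trace_moment \<mu> p w \<alpha> \<alpha> \<in> O(\<lambda>N. 1 / of_nat N)"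
      by (rule landau_o.big.in_cong)
    then show "trace_moment \<mu> p w \<alpha> \<beta> \<notin> O(\<lambda>N. 1 / of_nat N)"
      using balanced[of \<alpha> \<alpha>] by simp
  qed
  show "(\<lambda>N. trace_moment \<mu> p w \<alpha> \<beta> N - ?L \<alpha>) \<in> O(\<lambda>N. 1 / of_nat N)" if "\<forall>i<p. \<beta> i = \<alpha> i"
    using asym[of \<alpha> \<beta>] unfolding if_P[OF that] .
next
  fix \<alpha> \<beta> :: "nat \<Rightarrow> nat"
  assume "prob_space M \<and> prob_space.indep_vars M (\<lambda>_. borel) Z {..<p}
        \<and> (\<forall>i<p. standard_complex_gaussian M (Z i))"
  then have g: "prob_space M" "prob_space.indep_vars M (\<lambda>_. borel) Z {..<p}"
    "\<And>i. i < p \<Longrightarrow> standard_complex_gaussian M (Z i)" by auto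
  have "trace_moment \<mu> p w \<alpha> \<beta> \<longlonglongrightarrow>
     (if \<forall>i<p. \<beta> i = \<alpha> i then \<Prod>i<p. fact (\<alpha> i) * of_nat (rotation_count (w i)) ^ \<alpha> i else 0)"
    by (intro tendsto_of_bigo_inverse trace_moment_asymptotics haar words distinct)
  then show "let G = (\<lambda>x. \<Prod>i<p. (of_real (sqrt (rotation_count (w i))) * Z i x) ^ \<alpha> i
                       * cnj (of_real (sqrt (rotation_count (w i))) * Z i x) ^ \<beta> i)
        in integrable M G \<and> trace_moment \<mu> p w \<alpha> \<beta> \<longlonglongrightarrow> (\<integral>x. G x \<partial>M)"
    using independent_gaussian_moment[OF g, of "\<lambda>i. real (rotation_count (w i))" \<alpha> \<beta>]
    by (simp only: Let_def of_nat_0_le_iff of_real_of_nat_eq)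
qed

end
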